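(* Let $G$ be an infinite simple graph on countably many vertices labeled by $\mathbb{N}$, let $\Lambda\subset\mathbb{R}$ be compact and infinite with set of limit points $\Lambda'$, and let $T$ be a constructed solution of the SISP with data $(G,\Lambda)$ (as defined in the context). Then any isolated eigenvalue of $T$ has multiplicity one; that is, $$\dim\ker(T-\lambda I)=1\quad\text{for all }\lambda\in\sigma(T)\setminus\sigma_{\mathrm{ess}}(T)=\Lambda\setminus\Lambda'.$$
   Context: All matrices are real. For a symmetric matrix $A$ (finite, or infinite and indexed by $\mathbb{N}$), a simple graph $G$ is the graph of $A$ when for all $i\ne j$, $A_{ij}\neq 0$ if and only if $i$ and $j$ are adjacent in $G$. $G[S]$ is the subgraph of $G$ induced on $S$. A finite symmetric matrix $A$ has the Weak Spectral Property (WSP) if $X=O$ is the only symmetric matrix $X$ of the same size with $X\circ I=O$ (entrywise product, i.e. $X$ has zero diagonal) and $XA-AX=O$. Constructed solution of the SISP (structured inverse spectrum problem) with data $(G,\Lambda)$: choose a countable dense subset $\{\lambda_1,\lambda_2,\dots\}$ of $\Lambda$, enumerated without repetition. Choose $n\times n$ real symmetric matrices $\widetilde A_n$, $n\ge 1$, with $\widetilde A_1=[\lambda_1]$, such that for every $n$: the graph of $\widetilde A_n$ is $G[\{1,\dots,n\}]$; the spectrum of $\widetilde A_n$ is $\{\lambda_1,\dots,\lambda_n\}$; $\widetilde A_n$ has the WSP; $\widetilde A_{n+1}$ is obtained from $\widetilde A_n\oplus[\lambda_{n+1}]$ by changing only diagonal entries and the off-diagonal entries in the last row and last column; and $\|\widetilde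 A_n\oplus[\lambda_{n+1}]-\widetilde A_{n+1}\|_{\mathrm{op}}<2^{-n}$, where $\|\cdot\|_{\mathrm{op}}$ is the operator norm. Let $T_n$ be the bounded operator on $\ell^2(\mathbb{N})$ whose matrix in the standard basis is $\widetilde A_n\oplus\operatorname{diag}(\lambda_{n+1},\lambda_{n+2},\dots)$. The sequence $(T_n)$ converges in operator norm, and $T=\lim_{n\to\infty}T_n$ is called a constructed solution of the SISP with data $(G,\Lambda)$ (relative to $\{\lambda_1,\lambda_2,\dots\}$). The essential spectrum is $\sigma_{\mathrm{ess}}(T)=\{\lambda\in\mathbb{C}\mid T-\lambda I\text{ is not a Fredholm operator}\}$; for self-adjoint $T$ this equals $\sigma(T)\setminus\sigma_{\mathrm{discr}}(T)$, where $\sigma_{\mathrm{discr}}(T)$ is the set of isolated eigenvalues of $T$ (eigenvalues that are isolated points of $\sigma(T)$) of finite multiplicity. *)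

theory Defs
  imports "HOL-Analysis.Analysis" "Jordan_Normal_Form.Spectral_Radius"
begin

section \<open>The complex sequence space \<open>\<ell>\<^sup>2(\<nat>)\<close>\<close>

typedef ell2 = "{x :: nat \<Rightarrow> complex. summable (\<lambda>i. (cmod (x i))\<^sup>2)}"
  morphisms coord Abs_ell2
  by (rule exI[of _ "\<lambda>_. 0"]) simp

setup_lifting type_definition_ell2

lemma summable_coord: "summable (\<lambda>i. (cmod (coord x i))\<^sup>2)"
  using coord[of x] by simp

lemma ell2_eqI: "(\<And>i. coord x i = coord y i) \<Longrightarrow> x = y"
  by (metis coord_inject ext)

lemma cmod_add_sq_le: "(cmod (a + b))\<^sup>2 \<le> 2 * (cmod a)\<^sup>2 + 2 * (cmod b)\<^sup>2"
proof -
  have "(cmod (a + b))\<^sup>2 \<le> (cmod a + cmod b)\<^sup>2"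
    by (simp add: norm_triangle_ineq power_mono)
  also have "\<dots> \<le> 2 * (cmod a)\<^sup>2 + 2 * (cmod b)\<^sup>2"
    using sum_squares_bound[of "cmod a" "cmod b"] by (simp add: power2_sum)
  finally show ?thesis .
qed

lemma summable_sq_add:
  assumes "summable (\<lambda>i. (cmod (x i))\<^sup>2)" "summable (\<lambda>i. (cmod (y i))\<^sup>2)"
  shows "summable (\<lambda>i. (cmod (x i + y i))\<^sup>2)"
  by (rule summable_comparison_test'[where g = "\<lambda>i. 2 * (cmod (x i))\<^sup>2 + 2 * (cmod (y i))\<^sup>2" and N = 0])
     (use assms cmod_add_sq_le in \<open>auto intro!: summable_add summable_mult\<close>)

lemma summable_sq_mult:
  "summable (\<lambda>i. (cmod (x i))\<^sup>2) \<Longrightarrow> summable (\<lambda>i. (cmod (c * x i))\<^sup>2)"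
  by (simp add: norm_mult power_mult_distrib summable_mult)

lemma summable_inner:
  assumes "summable (\<lambda>i. (cmod (x i))\<^sup>2)" "summable (\<lambda>i. (cmod (y i))\<^sup>2)"
  shows "summable (\<lambda>i. inner (x i) (y i))"
proof (rule summable_comparison_test'[where g = "\<lambda>i. (cmod (x i))\<^sup>2 + (cmod (y i))\<^sup>2" and N = 0])
  show "summable (\<lambda>i. (cmod (x i))\<^sup>2 + (cmod (y i))\<^sup>2)"
    using assms by (rule summable_add)
  fix i
  have "\<bar>inner (x i) (y i)\<bar> \<le> cmod (x i) * cmod (y i)"
    by (rule Cauchy_Schwarz_ineq2)
  also have "\<dots> \<le> (cmod (x i))\<^sup>2 + (cmod (y i))\<^sup>2"
    using sum_squares_bound[of "cmod (x i)" "cmod (y i)"]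
      mult_nonneg_nonneg[OF norm_ge_zero[of "x i"] norm_ge_zero[of "y i"]] by linarith
  finally show "norm (inner (x i) (y i)) \<le> (cmod (x i))\<^sup>2 + (cmod (y i))\<^sup>2"
    by simp
qed

instantiation ell2 :: real_vector
begin

lift_definition zero_ell2 :: ell2 is "\<lambda>_. 0" by simp
lift_definition plus_ell2 :: "ell2 \<Rightarrow> ell2 \<Rightarrow> ell2" is "\<lambda>x y i. x i + y i"
  by (rule summable_sq_add)
lift_definition uminus_ell2 :: "ell2 \<Rightarrow> ell2" is "\<lambda>x i. - x i" by simp
lift_definition minus_ell2 :: "ell2 \<Rightarrow> ell2 \<Rightarrow> ell2" is "\<lambda>x y i. x i - y i"
proof -
  fix x y :: "nat \<Rightarrow> complex"
  assume "summable (\<lambda>i. (cmod (x i))\<^sup>2)" "summable (\<lambda>i. (cmod (y i))\<^sup>2)"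
  then show "summable (\<lambda>i. (cmod (x i - y i))\<^sup>2)"
    using summable_sq_add[of x "\<lambda>i. - y i"] by simp
qed
lift_definition scaleR_ell2 :: "real \<Rightarrow> ell2 \<Rightarrow> ell2" is "\<lambda>r x i. complex_of_real r * x i"
  by (rule summable_sq_mult)

instance
  by standard (transfer; simp add: fun_eq_iff algebra_simps)+

end

text \<open>
  The inner product of the type class is the real part of the usual Hermitian one;
  the norm it induces is the usual \<open>\<ell>\<^sup>2\<close>-norm.
\<close>

instantiation ell2 :: real_inner
begin

lift_definition inner_ell2 :: "ell2 \<Rightarrow> ell2 \<Rightarrow> real" is "\<lambda>x y. \<Sum>i. inner (x i) (y i)" .
definition norm_ell2 :: "ell2 \<Rightarrow> real" where "norm_ell2 x = sqrt (inner x x)"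
definition dist_ell2 :: "ell2 \<Rightarrow> ell2 \<Rightarrow> real" where "dist_ell2 x y = norm (x - y)"
definition sgn_ell2 :: "ell2 \<Rightarrow> ell2" where "sgn_ell2 x = scaleR (inverse (norm x)) x"
definition uniformity_ell2 :: "(ell2 \<times> ell2) filter"
  where "uniformity_ell2 = (INF e\<in>{0<..}. principal {(x, y). dist x y < e})"
definition open_ell2 :: "ell2 set \<Rightarrow> bool"
  where "open_ell2 U \<longleftrightarrow> (\<forall>x\<in>U. eventually (\<lambda>(x', y). x' = x \<longrightarrow> y \<in> U) uniformity)"

instance
proof
  fix x y z :: ell2 and r :: real
  show "inner x y = inner y x"
    by transfer (simp add: inner_commute)
  show "inner (x + y) z = inner x z + inner y z"
    by transfer (simp add: inner_add_left suminf_add summable_inner)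
  show "inner (r *\<^sub>R x) y = r * inner x y"
    by transfer (simp add: suminf_mult summable_inner flip: scaleR_conv_of_real)
  show "0 \<le> inner x x"
    by transfer (simp add: suminf_nonneg summable_inner)
  show "inner x x = 0 \<longleftrightarrow> x = 0"
    by transfer (auto simp: suminf_eq_zero_iff summable_inner fun_eq_iff)
qed (simp_all add: norm_ell2_def dist_ell2_def sgn_ell2_def uniformity_ell2_def open_ell2_def)

end

lemma norm_ell2_eq: "norm (x :: ell2) = sqrt (\<Sum>i. (cmod (coord x i))\<^sup>2)"
  by (simp add: norm_ell2_def inner_ell2.rep_eq power2_norm_eq_inner)

lemma norm_coord_le: "cmod (coord x i) \<le> norm x"
proof -
  have "(cmod (coord x i))\<^sup>2 \<le> (\<Sum>i. (cmod (coord x i))\<^sup>2)"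
    using sum_le_suminf[OF summable_coord[of x], of "{i}"] by simp
  then show ?thesis
    by (simp add: norm_ell2_eq real_le_rsqrt)
qed

instance ell2 :: complete_space
proof
  fix X :: "nat \<Rightarrow> ell2"
  assume C: "Cauchy X"
  have "Cauchy (\<lambda>n. coord (X n) i)" for i
  proof (rule metric_CauchyI)
    fix e :: real assume "0 < e"
    then obtain M where M: "\<And>m n. m \<ge> M \<Longrightarrow> n \<ge> M \<Longrightarrow> dist (X m) (X n) < e"
      using metric_CauchyD[OF C] by blast
    have "dist (coord (X m) i) (coord (X n) i) < e" if "m \<ge> M" "n \<ge> M" for m n
      using M[OF that] norm_coord_le[of "X m - X n" i]
      by (simp add: dist_norm minus_ell2.rep_eq)
    then show "\<exists>M. \<forall>m\<ge>M. \<forall>n\<ge>M. dist (coord (X m) i) (coord (X n) i) < e" by blast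
  qed
  then have "\<forall>i. \<exists>l. (\<lambda>n. coord (X n) i) \<longlonglongrightarrow> l"
    using Cauchy_convergent convergent_def by blast
  then obtain l where l: "\<And>i. (\<lambda>n. coord (X n) i) \<longlonglongrightarrow> l i" by metis
  have fin: "\<exists>M. \<forall>n\<ge>M. \<forall>k. (\<Sum>i<k. (cmod (coord (X n) i - l i))\<^sup>2) \<le> e\<^sup>2"
    if e: "0 < e" for e
  proof -
    obtain M where M: "\<And>m n. m \<ge> M \<Longrightarrow> n \<ge> M \<Longrightarrow> dist (X m) (X n) < e"
      using metric_CauchyD[OF C e] by blast
    have "(\<Sum>i<k. (cmod (coord (X n) i - l i))\<^sup>2) \<le> e\<^sup>2" if n: "n \<ge> M" for n k
    proof (rule tendsto_upperbound)
      show "(\<lambda>m. \<Sum>i<k. (cmod (coord (X n) i - coord (X m) i))\<^sup>2)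
              \<longlonglongrightarrow> (\<Sum>i<k. (cmod (coord (X n) i - l i))\<^sup>2)"
        by (intro tendsto_intros l)
      have "(\<Sum>i<k. (cmod (coord (X n) i - coord (X m) i))\<^sup>2) \<le> e\<^sup>2" if "m \<ge> M" for m
      proof -
        have "(\<Sum>i<k. (cmod (coord (X n - X m) i))\<^sup>2) \<le> (\<Sum>i. (cmod (coord (X n - X m) i))\<^sup>2)"
          by (intro sum_le_suminf summable_coord) auto
        also have "\<dots> = (norm (X n - X m))\<^sup>2"
          by (simp add: norm_ell2_eq suminf_nonneg summable_coord)
        also have "\<dots> \<le> e\<^sup>2"
          using M[OF n that] by (intro power_mono) (auto simp: dist_norm)
        finally show ?thesis by (simp add: minus_ell2.rep_eq)
      qed
      then show "eventually (\<lambda>m. (\<Sum>i<k. (cmod (coord (X n) i - coord (X m) i))\<^sup>2) \<le> e\<^sup>2) sequentially"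
        using eventually_sequentially by blast
    qed simp
    then show ?thesis by blast
  qed
  have summ: "summable (\<lambda>i. (cmod (f i))\<^sup>2)"
    if "\<And>k. (\<Sum>i<k. (cmod (f i))\<^sup>2) \<le> B" for f :: "nat \<Rightarrow> complex" and B
    using that by (intro summableI_nonneg_bounded) auto
  have sl: "summable (\<lambda>i. (cmod (l i))\<^sup>2)"
  proof -
    obtain M where M: "\<And>k. (\<Sum>i<k. (cmod (coord (X M) i - l i))\<^sup>2) \<le> 1\<^sup>2"
      using fin[of 1] by auto
    have "summable (\<lambda>i. (cmod (- (coord (X M) i - l i)))\<^sup>2)"
      unfolding norm_minus_cancel by (rule summ[OF M])
    from summable_sq_add[OF summable_coord[of "X M"] this] show ?thesis by simp
  qed
  define L where "L = Abs_ell2 l"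
  have L: "coord L = l" using sl by (simp add: L_def Abs_ell2_inverse)
  have "X \<longlonglongrightarrow> L"
  proof (rule metric_LIMSEQ_I)
    fix r :: real assume r: "0 < r"
    then obtain M where M: "\<And>n k. n \<ge> M \<Longrightarrow> (\<Sum>i<k. (cmod (coord (X n) i - l i))\<^sup>2) \<le> (r/2)\<^sup>2"
      using fin[of "r/2"] by auto
    have "dist (X n) L < r" if "n \<ge> M" for n
    proof -
      have "(\<Sum>i. (cmod (coord (X n - L) i))\<^sup>2) \<le> (r/2)\<^sup>2"
        by (rule suminf_le_const[OF summable_coord]) (use M[OF that] L in \<open>simp add: minus_ell2.rep_eq\<close>)
      then have "norm (X n - L) \<le> r/2"
        unfolding norm_ell2_eq using r by (intro real_le_lsqrt) simp_all
      then show ?thesis using r by (simp add: dist_norm)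
    qed
    then show "\<exists>M. \<forall>n\<ge>M. dist (X n) L < r" by blast
  qed
  then show "convergent X" by (auto simp: convergent_def)
qed

lift_definition scaleC :: "complex \<Rightarrow> ell2 \<Rightarrow> ell2" (infixr "*\<^sub>C" 75) is "\<lambda>c x i. c * x i"
  by (rule summable_sq_mult)

interpretation cell2: vector_space scaleC
  by standard (transfer; simp add: fun_eq_iff algebra_simps)+

lift_definition ket :: "nat \<Rightarrow> ell2" is "\<lambda>j i. if i = j then 1 else 0"
proof -
  fix j :: nat
  have "summable (\<lambda>i. (cmod (if i = j then 1 else 0))\<^sup>2)"
    by (rule summable_finite[of "{j}"]) auto
  then show "summable (\<lambda>i. (cmod (if i = j then 1 else 0))\<^sup>2)" .
qed


section \<open>Bounded operators on \<open>\<ell>\<^sup>2(\<nat>)\<close>\<close>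

definition bounded_clinear :: "(ell2 \<Rightarrow> ell2) \<Rightarrow> bool" where
  "bounded_clinear T \<longleftrightarrow> bounded_linear T \<and> (\<forall>c x. T (c *\<^sub>C x) = c *\<^sub>C T x)"

definition has_matrix :: "(ell2 \<Rightarrow> ell2) \<Rightarrow> (nat \<Rightarrow> nat \<Rightarrow> real) \<Rightarrow> bool" where
  "has_matrix T M \<longleftrightarrow> (\<forall>i j. coord (T (ket j)) i = complex_of_real (M i j))"

definition shifted :: "(ell2 \<Rightarrow> ell2) \<Rightarrow> complex \<Rightarrow> ell2 \<Rightarrow> ell2" where
  "shifted T \<mu> = (\<lambda>x. T x - \<mu> *\<^sub>C x)"

definition op_kernel :: "(ell2 \<Rightarrow> ell2) \<Rightarrow> ell2 set" where
  "op_kernel F = {x. F x = 0}"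

definition bounded_invertible :: "(ell2 \<Rightarrow> ell2) \<Rightarrow> bool" where
  "bounded_invertible F \<longleftrightarrow> (\<exists>S. bounded_clinear S \<and> S \<circ> F = id \<and> F \<circ> S = id)"

definition op_spectrum :: "(ell2 \<Rightarrow> ell2) \<Rightarrow> complex set" where
  "op_spectrum T = {\<mu>. \<not> bounded_invertible (shifted T \<mu>)}"

text \<open>
  Finite dimension is expressed by a finite spanning set, since \<^const>\<open>cell2.dim\<close> is \<open>0\<close> on
  infinite-dimensional subspaces.  The last conjunct says that the range has finite codimension.
\<close>

definition fredholm :: "(ell2 \<Rightarrow> ell2) \<Rightarrow> bool" where
  "fredholm F \<longleftrightarrow> bounded_clinear F
     \<and> (\<exists>B. finite B \<and> op_kernel F \<subseteq> cell2.span B)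
     \<and> closed (range F)
     \<and> (\<exists>B. finite B \<and> cell2.span (range F \<union> B) = UNIV)"

definition ess_spectrum :: "(ell2 \<Rightarrow> ell2) \<Rightarrow> complex set" where
  "ess_spectrum T = {\<mu>. \<not> fredholm (shifted T \<mu>)}"

definition op_eigenvalue :: "(ell2 \<Rightarrow> ell2) \<Rightarrow> complex \<Rightarrow> bool" where
  "op_eigenvalue T \<mu> \<longleftrightarrow> (\<exists>x. x \<noteq> 0 \<and> T x = \<mu> *\<^sub>C x)"

definition isolated_eigenvalue :: "(ell2 \<Rightarrow> ell2) \<Rightarrow> complex \<Rightarrow> bool" where
  "isolated_eigenvalue T \<mu> \<longleftrightarrow> op_eigenvalue T \<mu> \<and> \<mu> isolated_in op_spectrum T"


section \<open>Graphs and finite symmetric matrices\<close>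

text \<open>
  A simple graph labelled by \<open>\<nat>\<close> is given by its adjacency relation, a symmetric and
  irreflexive relation on \<^typ>\<open>nat\<close>.
\<close>

definition induced_subgraph :: "(nat \<Rightarrow> nat \<Rightarrow> bool) \<Rightarrow> nat set \<Rightarrow> nat \<Rightarrow> nat \<Rightarrow> bool" where
  "induced_subgraph E S i j \<longleftrightarrow> i \<in> S \<and> j \<in> S \<and> E i j"

definition is_graph_of :: "(nat \<Rightarrow> nat \<Rightarrow> bool) \<Rightarrow> real mat \<Rightarrow> bool" where
  "is_graph_of E A \<longleftrightarrow>
     (\<forall>i<dim_row A. \<forall>j<dim_col A. i \<noteq> j \<longrightarrow> (A $$ (i, j) \<noteq> 0 \<longleftrightarrow> E i j))"

definition symmetric_mat :: "real mat \<Rightarrow> bool" where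
  "symmetric_mat A \<longleftrightarrow> transpose_mat A = A"

definition WSP :: "nat \<Rightarrow> real mat \<Rightarrow> bool" where
  "WSP n A \<longleftrightarrow>
     (\<forall>X\<in>carrier_mat n n. symmetric_mat X \<and> (\<forall>i<n. X $$ (i, i) = 0) \<and> X * A - A * X = 0\<^sub>m n n
        \<longrightarrow> X = 0\<^sub>m n n)"

definition mat_op_norm :: "real mat \<Rightarrow> real" where
  "mat_op_norm A =
     Sup {L2_set (vec_index (mult_mat_vec A v)) {..<dim_row A} | v.
            v \<in> carrier_vec (dim_col A) \<and> L2_set (vec_index v) {..<dim_col A} \<le> 1}"

definition direct_sum1 :: "real mat \<Rightarrow> real \<Rightarrow> real mat" where
  "direct_sum1 A c = diag_block_mat [A, mat 1 1 (\<lambda>_. c)]"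


section \<open>Constructed solutions of the structured inverse spectrum problem\<close>

text \<open>
  The matrix of \<open>A \<oplus> diag(lam n, lam (n + 1), \<dots>)\<close> for \<open>A\<close> of size \<open>n\<close>.
\<close>

definition extended_matrix :: "nat \<Rightarrow> real mat \<Rightarrow> (nat \<Rightarrow> real) \<Rightarrow> nat \<Rightarrow> nat \<Rightarrow> real" where
  "extended_matrix n A lam i j =
     (if i < n \<and> j < n then A $$ (i, j) else if i = j then lam i else 0)"

text \<open>
  Vertices, basis vectors, matrix entries and the sequence \<open>lam\<close> are all indexed from \<open>0\<close>:
  \<open>lam k\<close> is \<open>\<lambda>\<close> with subscript \<open>k + 1\<close>.  The matrix \<open>A n\<close> has size \<open>n\<close> and is only
  constrained for \<open>n \<ge> 1\<close>, and likewise the operator \<open>Tn n\<close>.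
\<close>

definition constructed_solution ::
  "(nat \<Rightarrow> nat \<Rightarrow> bool) \<Rightarrow> real set \<Rightarrow> (nat \<Rightarrow> real) \<Rightarrow> (ell2 \<Rightarrow> ell2) \<Rightarrow> bool" where
  "constructed_solution E \<Lambda> lam T \<longleftrightarrow>
     inj lam \<and> range lam \<subseteq> \<Lambda> \<and> \<Lambda> \<subseteq> closure (range lam) \<and>
     (\<exists>A Tn.
        A 1 = mat 1 1 (\<lambda>_. lam 0) \<and>
        (\<forall>n\<ge>1.
           A n \<in> carrier_mat n n \<and> symmetric_mat (A n) \<and>
           is_graph_of (induced_subgraph E {..<n}) (A n) \<and>
           spectrum (A n) = lam ` {..<n} \<and>
           WSP n (A n) \<and>
           (\<forall>i<n. \<forall>j<n. i \<noteq> j \<longrightarrow>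
              A (Suc n) $$ (i, j) = direct_sum1 (A n) (lam n) $$ (i, j)) \<and>
           mat_op_norm (direct_sum1 (A n) (lam n) - A (Suc n)) < 1 / 2 ^ n) \<and>
        (\<forall>n\<ge>1. bounded_clinear (Tn n) \<and> has_matrix (Tn n) (extended_matrix n (A n) lam)) \<and>
        bounded_clinear T \<and>
        (\<lambda>n. onorm (\<lambda>x. Tn n x - T x)) \<longlonglongrightarrow> 0)"

end

theory Submission
  imports Defs
begin

text \<open>
  Each finite matrix in the construction is real symmetric with as many distinct eigenvalues as rows,
  so each approximating operator is unitarily equivalent to the diagonal operator with the
  simple eigenvalues \<open>lam 0, lam 1, \<dots>\<close>, and \<open>T\<close> is a norm limit of such operators. This determines
  how \<open>T - \<mu>\<close> behaves for each \<open>\<mu>\<close>.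

  If \<open>\<mu>\<close> has positive distance from \<open>\<Lambda>\<close>, the approximants of \<open>T - \<mu>\<close> have inverses of uniformly bounded
  norm, and so \<open>T - \<mu>\<close> is invertible (\<open>bounded_invertible_near_diagonalized\<close>).

  If \<open>\<mu> = lam k\<close> is an isolated point of \<open>\<Lambda>\<close>, then \<open>\<mu>\<close> is a simple eigenvalue of every late approximant
  \<open>S\<close>, at a fixed distance from all others. Adding a multiple of its rank-one spectral projection to
  \<open>S - \<mu>\<close> makes that operator invertible with an explicit bound, and if \<open>S\<close> is close enough to \<open>T\<close>,
  the same correction makes \<open>T - \<mu>\<close> invertible. An operator that differs from an invertible one by
  rank one is Fredholm with kernel of dimension at most one; the kernel is not zero, because the
  eigenvectors of the approximants are unit vectors that \<open>T - \<mu>\<close> maps to vectors tending to zero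
  (\<open>rank_one_perturbation_kernel_fredholm\<close>).

  If \<open>\<mu>\<close> is a limit point of \<open>\<Lambda>\<close>, then the basis vectors \<open>ket j\<close> with \<open>lam j\<close> near \<open>\<mu>\<close> and \<open>j\<close> large give
  approximate kernel vectors of \<open>T - \<mu>\<close> that satisfy any prescribed finite set of orthogonality
  conditions. Since \<open>T - \<mu>\<close> is symmetric, its range cannot have finite codimension
  (\<open>not_fredholm_if_symmetric_approximate_kernel\<close>).

  Hence the spectrum is \<open>\<Lambda>\<close>, its Fredholm part consists of the isolated points of \<open>\<Lambda>\<close>, and there
  the kernel is a line.
\<close>

section \<open>Orthonormal eigenbases of symmetric matrices\<close>

text \<open>
  Eigenvectors for the \<open>n\<close> distinct eigenvalues are orthogonal by symmetry of \<open>A\<close>; normalised, they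
  are the columns of a square matrix with left inverse its transpose, which is then also a right
  inverse. So the rows are orthonormal too. The matrix is passed on as a function, the form in
  which its entries enter operators on \<^typ>\<open>ell2\<close>.
\<close>

lemma orthonormal_eigenbasis:
  fixes A :: "real mat" and lam :: "nat \<Rightarrow> real"
  assumes A: "A \<in> carrier_mat n n" and sym: "symmetric_mat A"
    and inj: "inj_on lam {..<n}"
    and ev: "\<And>k. k < n \<Longrightarrow> eigenvalue A (lam k)"
  obtains P :: "nat \<Rightarrow> nat \<Rightarrow> real" where
    "\<And>i k. i < n \<Longrightarrow> k < n \<Longrightarrow> (\<Sum>j<n. A $$ (i, j) * P j k) = lam k * P i k"
    "\<And>j k. j < n \<Longrightarrow> k < n \<Longrightarrow> (\<Sum>i<n. P i j * P i k) = (if j = k then 1 else 0)"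
    "\<And>i j. i < n \<Longrightarrow> j < n \<Longrightarrow> (\<Sum>k<n. P i k * P j k) = (if i = j then 1 else 0)"
proof -
  have "\<forall>k. \<exists>v. k < n \<longrightarrow> eigenvector A v (lam k)"
    using ev unfolding eigenvalue_def by blast
  then obtain v where v: "\<And>k. k < n \<Longrightarrow> eigenvector A (v k) (lam k)" by metis
  define w where "w k i = v k $ i" for k i
  have vc: "v k \<in> carrier_vec n" "v k \<noteq> 0\<^sub>v n" "A *\<^sub>v v k = lam k \<cdot>\<^sub>v v k" if "k < n" for k
    using v[OF that] A unfolding eigenvector_def by auto
  have Aw: "(\<Sum>j<n. A $$ (i, j) * w k j) = lam k * w k i" if i: "i < n" and k: "k < n" for i k
  proof -
    have "(A *\<^sub>v v k) $ i = (\<Sum>j<n. A $$ (i, j) * w k j)"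
      using A vc(1)[OF k] i
      by (auto simp: scalar_prod_def w_def atLeast0LessThan intro!: sum.cong)
    then show ?thesis using vc[OF k] i by (simp add: w_def)
  qed
  have symA: "A $$ (i, j) = A $$ (j, i)" if "i < n" "j < n" for i j
    using sym A that unfolding symmetric_mat_def by (metis carrier_matD index_transpose_mat(1))
  have orth: "(\<Sum>i<n. w j i * w k i) = 0" if j: "j < n" and k: "k < n" and ne: "j \<noteq> k" for j k
  proof -
    have "lam j * (\<Sum>i<n. w j i * w k i) = (\<Sum>i<n. (\<Sum>l<n. A $$ (i, l) * w j l) * w k i)"
      by (simp add: sum_distrib_left Aw j mult.assoc)
    also have "\<dots> = (\<Sum>i<n. \<Sum>l<n. w j l * (A $$ (l, i) * w k i))"
      by (intro sum.cong refl) (auto simp: sum_distrib_right symA intro!: sum.cong)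
    also have "\<dots> = (\<Sum>l<n. w j l * (\<Sum>i<n. A $$ (l, i) * w k i))"
      by (subst sum.swap) (simp add: sum_distrib_left)
    also have "\<dots> = lam k * (\<Sum>i<n. w j i * w k i)"
      unfolding sum_distrib_left by (intro sum.cong refl) (simp add: Aw k flip: sum_distrib_left)
    finally show ?thesis using inj j k ne by (auto simp: inj_on_def)
  qed
  define s where "s k = (\<Sum>i<n. w k i * w k i)" for k
  have s: "0 < s k" if k: "k < n" for k
  proof -
    obtain i where "i < n" "w k i \<noteq> 0"
      using vc(1,2)[OF k] unfolding w_def by (metis carrier_vecD eq_vecI index_zero_vec)
    then show ?thesis unfolding s_def
      by (intro sum_pos2[of _ i]) (auto simp: zero_less_mult_iff linorder_neq_iff)
  qed
  define P where "P i k = w k i / sqrt (s k)" for i k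
  have P1: "(\<Sum>j<n. A $$ (i, j) * P j k) = lam k * P i k" if "i < n" "k < n" for i k
    using Aw[OF that] by (simp add: P_def sum_divide_distrib[symmetric])
  have P2: "(\<Sum>i<n. P i j * P i k) = (if j = k then 1 else 0)" if "j < n" "k < n" for j k
  proof -
    have "(\<Sum>i<n. P i j * P i k) = (\<Sum>i<n. w j i * w k i) / (sqrt (s j) * sqrt (s k))"
      by (simp add: P_def sum_divide_distrib)
    then show ?thesis
      using orth[OF that] s[OF that(1)] by (auto simp: s_def)
  qed
  define Q where "Q = mat n n (\<lambda>(i, j). P i j)"
  have Q: "Q \<in> carrier_mat n n" by (simp add: Q_def)
  have "transpose_mat Q * Q = 1\<^sub>m n"
    by (rule eq_matI) (auto simp: Q_def scalar_prod_def atLeast0LessThan P2)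
  then have QQ: "Q * transpose_mat Q = 1\<^sub>m n"
    using mat_mult_left_right_inverse[of "transpose_mat Q" n Q] Q by simp
  have P3: "(\<Sum>k<n. P i k * P j k) = (if i = j then 1 else 0)" if "i < n" "j < n" for i j
  proof -
    have "(Q * transpose_mat Q) $$ (i, j) = (\<Sum>k<n. P i k * P j k)"
      using that by (simp add: Q_def scalar_prod_def atLeast0LessThan)
    then show ?thesis using QQ that by simp
  qed
  show thesis using that[OF P1 P2 P3] .
qed

section \<open>Coordinates, norm and bounded operators on the sequence space\<close>

lemmas coord_simps [simp] =
  zero_ell2.rep_eq plus_ell2.rep_eq minus_ell2.rep_eq scaleR_ell2.rep_eq scaleC.rep_eq

lemma coord_ket [simp]: "coord (ket j) i = (if i = j then 1 else 0)"
  by (simp add: ket.rep_eq)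

lemma coord_sum [simp]: "coord (sum f B) i = (\<Sum>b\<in>B. coord (f b) i)"
  by (induction B rule: infinite_finite_induct) auto

lemma scaleR_ell2_conv_scaleC: "r *\<^sub>R (x :: ell2) = complex_of_real r *\<^sub>C x"
  by (rule ell2_eqI) simp

lemma inner_scaleC_left: "inner (c *\<^sub>C x) y = inner x (cnj c *\<^sub>C y)"
  by (simp add: inner_ell2.rep_eq inner_complex_def algebra_simps)

lemma norm_scaleC: "norm (c *\<^sub>C x) = cmod c * norm x"
  by (simp add: norm_ell2_eq norm_mult power_mult_distrib suminf_mult summable_coord real_sqrt_mult)

lemma norm_ket [simp]: "norm (ket j) = 1"
proof -
  have "(\<Sum>i. (cmod (coord (ket j) i))\<^sup>2) = (\<Sum>i\<in>{j}. (cmod (coord (ket j) i))\<^sup>2)"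
    by (rule suminf_finite) auto
  then show ?thesis by (simp add: norm_ell2_eq)
qed

lemma truncation_tendsto: "(\<lambda>m. \<Sum>j<m. coord x j *\<^sub>C ket j) \<longlonglongrightarrow> x"
proof -
  let ?f = "\<lambda>i. (cmod (coord x i))\<^sup>2"
  have eq: "norm ((\<Sum>j<m. coord x j *\<^sub>C ket j) - x) = sqrt (\<Sum>i. ?f (i + m))" for m
  proof -
    let ?d = "(\<Sum>j<m. coord x j *\<^sub>C ket j) - x"
    have c: "coord ?d i = (if i < m then 0 else - coord x i)" for i
      by (simp add: mult_delta_right)
    have "(\<Sum>i. (cmod (coord ?d i))\<^sup>2) = (\<Sum>i. (cmod (coord ?d (i + m)))\<^sup>2)"
      using suminf_split_initial_segment[OF summable_coord[of ?d], of m] c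
      by (simp del: coord_simps coord_sum)
    then have "norm ?d = sqrt (\<Sum>i. (cmod (coord ?d (i + m)))\<^sup>2)"
      by (simp only: norm_ell2_eq)
    also have "\<dots> = sqrt (\<Sum>i. ?f (i + m))"
      unfolding c by simp
    finally show ?thesis .
  qed
  have "(\<lambda>m. \<Sum>i. ?f (i + m)) \<longlonglongrightarrow> 0"
    using suminf_exist_split2[OF summable_coord[of x]] .
  then have "(\<lambda>m. sqrt (\<Sum>i. ?f (i + m))) \<longlonglongrightarrow> 0"
    using tendsto_real_sqrt[of _ 0] by simp
  then have "(\<lambda>m. norm ((\<Sum>j<m. coord x j *\<^sub>C ket j) - x)) \<longlonglongrightarrow> 0"
    unfolding eq .
  then show ?thesis
    by (rule LIM_zero_cancel[OF tendsto_norm_zero_cancel])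
qed

lemma bounded_clinearI:
  assumes "\<And>x y. F (x + y) = F x + F y" "\<And>c x. F (c *\<^sub>C x) = c *\<^sub>C F x"
    and "\<And>x. norm (F x) \<le> K * norm x"
  shows "bounded_clinear F"
  unfolding bounded_clinear_def using assms
  by (auto intro!: bounded_linear_intro[where K = K] simp: scaleR_ell2_conv_scaleC mult.commute)

lemma bounded_clinearD:
  assumes "bounded_clinear F"
  shows "bounded_linear F" "F (c *\<^sub>C x) = c *\<^sub>C F x" "F (x + y) = F x + F y"
    "F (x - y) = F x - F y" "F 0 = 0"
proof -
  show l: "bounded_linear F" and "F (c *\<^sub>C x) = c *\<^sub>C F x"
    using assms unfolding bounded_clinear_def by simp_all
  then interpret bounded_linear F by simp
  show "F (x + y) = F x + F y" "F (x - y) = F x - F y" "F 0 = 0"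
    by (rule add diff zero)+
qed

lemma bounded_clinear_sum: "bounded_clinear F \<Longrightarrow> F (sum f B) = (\<Sum>b\<in>B. F (f b))"
  by (rule linear_sum[OF bounded_linear.linear[OF bounded_clinearD(1)]])

lemma bounded_clinear_shifted:
  assumes "bounded_clinear F" shows "bounded_clinear (shifted F \<mu>)"
proof -
  define K where "K = onorm F"
  have K: "norm (F x) \<le> K * norm x" for x
    unfolding K_def by (rule onorm[OF bounded_clinearD(1)[OF assms]])
  show ?thesis
  proof (rule bounded_clinearI)
    show "norm (shifted F \<mu> x) \<le> (K + cmod \<mu>) * norm x" for x
      using norm_triangle_ineq4[of "F x" "\<mu> *\<^sub>C x"] K[of x]
      by (simp add: shifted_def norm_scaleC algebra_simps)
    show "shifted F \<mu> (x + y) = shifted F \<mu> x + shifted F \<mu> y" for x y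
      by (rule ell2_eqI) (simp add: shifted_def bounded_clinearD(3)[OF assms] algebra_simps)
    show "shifted F \<mu> (c *\<^sub>C x) = c *\<^sub>C shifted F \<mu> x" for c x
      by (rule ell2_eqI) (simp add: shifted_def bounded_clinearD(2)[OF assms] algebra_simps)
  qed
qed

section \<open>Finite blocks with a diagonal tail\<close>

text \<open>
  All operators that approximate \<open>T\<close>, and the unitary operators diagonalizing them, are of this
  form: a matrix on the first \<open>n\<close> coordinates and multiplication by \<open>a\<close> on the others. For unbounded
  \<open>a\<close> the value is unspecified, hence the hypothesis \<open>bounded (range a)\<close> below.
\<close>

definition block_op :: "nat \<Rightarrow> (nat \<Rightarrow> nat \<Rightarrow> complex) \<Rightarrow> (nat \<Rightarrow> complex) \<Rightarrow> ell2 \<Rightarrow> ell2" where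
  "block_op n M a x =
     Abs_ell2 (\<lambda>i. if i < n then \<Sum>j<n. M i j * coord x j else a i * coord x i)"

lemma coord_block_op:
  assumes "bounded (range a)"
  shows "coord (block_op n M a x) i =
    (if i < n then \<Sum>j<n. M i j * coord x j else a i * coord x i)"
proof -
  obtain B where B: "\<And>i. cmod (a i) \<le> B" using assms by (auto simp: bounded_iff)
  have B': "(cmod (a i * coord x i))\<^sup>2 \<le> B\<^sup>2 * (cmod (coord x i))\<^sup>2" for i
    using B[of i] by (simp add: norm_mult power_mult_distrib mult_right_mono power_mono)
  have "summable (\<lambda>i. (cmod (if i < n then \<Sum>j<n. M i j * coord x j else a i * coord x i))\<^sup>2)"
    by (rule summable_comparison_test'[where N = n, OF summable_mult[OF summable_coord[of x]]])
       (use B' in auto)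
  then show ?thesis by (simp add: block_op_def Abs_ell2_inverse)
qed

lemma block_op_linear:
  assumes "bounded (range a)"
  shows "block_op n M a (x + y) = block_op n M a x + block_op n M a y"
    "block_op n M a (c *\<^sub>C x) = c *\<^sub>C block_op n M a x"
  by (rule ell2_eqI; simp add: coord_block_op[OF assms] sum.distrib sum_distrib_left algebra_simps)+

lemma inner_block_op:
  assumes a: "bounded (range a)"
  shows "inner (block_op n M a x) y = inner x (block_op n (\<lambda>i j. cnj (M j i)) (\<lambda>i. cnj (a i)) y)"
proof -
  have a': "bounded (range (\<lambda>i. cnj (a i)))"
    using a by (simp add: bounded_iff)
  have ic: "inner (c * z) w = inner z (cnj c * w)" for c z w :: complex
    by (simp add: inner_complex_def algebra_simps)
  let ?x = "coord x" and ?y = "coord y"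
  let ?B = "block_op n M a x" and ?C = "block_op n (\<lambda>i j. cnj (M j i)) (\<lambda>i. cnj (a i)) y"
  have s: "inner u v = (\<Sum>i<n. inner (coord u i) (coord v i)) +
      (\<Sum>i. inner (coord u (i + n)) (coord v (i + n)))" for u v
    unfolding inner_ell2.rep_eq
    by (subst suminf_split_initial_segment[of _ n])
       (use summable_inner[OF summable_coord summable_coord] in \<open>auto simp: add.commute\<close>)
  have 1: "(\<Sum>i<n. inner (coord ?B i) (?y i)) = (\<Sum>i<n. inner (?x i) (coord ?C i))"
  proof -
    have "(\<Sum>i<n. inner (coord ?B i) (?y i)) = (\<Sum>i<n. \<Sum>j<n. inner (?x j) (cnj (M i j) * ?y i))"
      by (simp add: coord_block_op[OF a] inner_sum_left ic)
    also have "\<dots> = (\<Sum>j<n. \<Sum>i<n. inner (?x j) (cnj (M i j) * ?y i))"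
      by (rule sum.swap)
    finally show ?thesis by (simp add: coord_block_op[OF a'] inner_sum_right)
  qed
  show ?thesis
    unfolding s[of ?B] s[of x] 1 by (simp add: coord_block_op[OF a] coord_block_op[OF a'] ic)
qed

text \<open>
  A matrix determines a bounded operator because truncations converge in norm. The \<open>i\<close>-th
  coordinate of the image of a truncation is even eventually constant, as each row of the matrix
  is finitely supported.
\<close>

lemma operator_eq_block_op:
  assumes S: "bounded_clinear S" and M: "has_matrix S (extended_matrix n A lam)"
    and lam: "bounded (range lam)"
  shows "S = block_op n (\<lambda>i j. complex_of_real (A $$ (i, j))) (\<lambda>i. complex_of_real (lam i))"
proof
  fix x
  have b: "bounded (range (\<lambda>i. complex_of_real (lam i)))"
    using lam by (simp add: bounded_iff)
  show "S x = block_op n (\<lambda>i j. complex_of_real (A $$ (i, j))) (\<lambda>i. complex_of_real (lam i)) x"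
    (is "_ = ?B x")
  proof (rule ell2_eqI)
    fix i
    have cl: "bounded_linear (\<lambda>x. coord x i)"
      by (rule bounded_linear_intro[where K = 1]) (auto simp: norm_coord_le scaleR_conv_of_real)
    have "(\<lambda>m. coord (S (\<Sum>j<m. coord x j *\<^sub>C ket j)) i) \<longlonglongrightarrow> coord (S x) i"
      by (intro bounded_linear.tendsto[OF cl] bounded_linear.tendsto[OF bounded_clinearD(1)[OF S]]
            truncation_tendsto)
    moreover have "coord (S (\<Sum>j<m. coord x j *\<^sub>C ket j)) i = coord (?B x) i"
      if m: "m \<ge> n" "m > i" for m
    proof -
      have "coord (S (\<Sum>j<m. coord x j *\<^sub>C ket j)) i
          = (\<Sum>j<m. coord x j * complex_of_real (extended_matrix n A lam i j))"
        using M by (simp add: bounded_clinear_sum[OF S] bounded_clinearD[OF S] has_matrix_def)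
      also have "\<dots> = coord (?B x) i"
      proof (cases "i < n")
        case True
        have "(\<Sum>j<m. coord x j * complex_of_real (extended_matrix n A lam i j))
            = (\<Sum>j<n. coord x j * complex_of_real (extended_matrix n A lam i j))"
          using m True by (intro sum.mono_neutral_right) (auto simp: extended_matrix_def)
        then show ?thesis using True
          by (simp add: coord_block_op[OF b] extended_matrix_def mult.commute)
      next
        case False
        have "(\<Sum>j<m. coord x j * complex_of_real (extended_matrix n A lam i j))
            = (\<Sum>j\<in>{i}. coord x j * complex_of_real (extended_matrix n A lam i j))"
          using m False by (intro sum.mono_neutral_right) (auto simp: extended_matrix_def)
        then show ?thesis using False
          by (simp add: coord_block_op[OF b] extended_matrix_def mult.commute)
      qed
      finally show ?thesis .
    qed
    then have "(\<lambda>m. coord (S (\<Sum>j<m. coord x j *\<^sub>C ket j)) i) \<longlonglongrightarrow> coord (?B x) i"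
      by (intro tendsto_eventually eventually_sequentiallyI[of "max n (Suc i)"]) auto
    ultimately show "coord (S x) i = coord (?B x) i"
      using LIMSEQ_unique by blast
  qed
qed


lemma block_op_block_op:
  assumes "bounded (range a)" "bounded (range b)"
  shows "block_op n M a (block_op n N b x)
    = block_op n (\<lambda>i j. \<Sum>k<n. M i k * N k j) (\<lambda>i. a i * b i) x"
proof (rule ell2_eqI)
  obtain K L where KL: "\<And>i. cmod (a i) \<le> K" "\<And>i. cmod (b i) \<le> L"
    using assms by (auto simp: bounded_iff)
  have "cmod (a i * b i) \<le> K * L" for i
    using KL(1)[of i] KL(2)[of i] norm_ge_zero[of "a i"] unfolding norm_mult
    by (intro mult_mono) (linarith | simp)+
  then have ab: "bounded (range (\<lambda>i. a i * b i))" by (auto simp: bounded_iff)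
  fix i
  have "(\<Sum>k<n. M i k * (\<Sum>j<n. N k j * coord x j)) = (\<Sum>j<n. (\<Sum>k<n. M i k * N k j) * coord x j)"
    by (simp add: sum_distrib_left sum_distrib_right mult.assoc) (rule sum.swap)
  then show "coord (block_op n M a (block_op n N b x)) i
      = coord (block_op n (\<lambda>i j. \<Sum>k<n. M i k * N k j) (\<lambda>i. a i * b i) x) i"
    by (simp add: coord_block_op assms ab)
qed

lemma block_op_cong:
  assumes "bounded (range a)" "\<And>i j. i < n \<Longrightarrow> j < n \<Longrightarrow> M i j = N i j"
  shows "block_op n M a x = block_op n N a x"
  by (rule ell2_eqI) (simp add: coord_block_op assms)

definition diag_op :: "(nat \<Rightarrow> complex) \<Rightarrow> ell2 \<Rightarrow> ell2" where
  "diag_op a = block_op 0 (\<lambda>_ _. 0) a"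

lemma coord_diag_op: "bounded (range a) \<Longrightarrow> coord (diag_op a x) i = a i * coord x i"
  by (simp add: diag_op_def coord_block_op)

lemma diag_op_eq_block_op:
  "bounded (range a) \<Longrightarrow> diag_op a x = block_op n (\<lambda>i j. if i = j then a i else 0) a x"
  by (rule ell2_eqI) (simp add: coord_diag_op coord_block_op mult_delta_left)

lemma norm_le_by_coord:
  assumes "\<And>i. cmod (coord x i) \<le> K * cmod (coord y i)" and "0 \<le> K"
  shows "norm x \<le> K * norm y"
proof -
  have "(\<Sum>i. (cmod (coord x i))\<^sup>2) \<le> (\<Sum>i. K\<^sup>2 * (cmod (coord y i))\<^sup>2)"
    using assms by (intro suminf_le summable_mult summable_coord)
      (simp add: power_mono flip: power_mult_distrib)
  then have "sqrt (\<Sum>i. (cmod (coord x i))\<^sup>2) \<le> sqrt (\<Sum>i. K\<^sup>2 * (cmod (coord y i))\<^sup>2)"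
    by simp
  then show ?thesis
    using assms(2) by (simp add: norm_ell2_eq suminf_mult summable_coord real_sqrt_mult)
qed

lemma bounded_clinear_diag_op:
  assumes "bounded (range a)" shows "bounded_clinear (diag_op a)"
proof -
  obtain K where K: "\<And>i. cmod (a i) \<le> K" using assms by (auto simp: bounded_iff)
  show ?thesis
  proof (rule bounded_clinearI)
    show "norm (diag_op a x) \<le> K * norm x" for x
      using K order_trans[OF norm_ge_zero K]
      by (intro norm_le_by_coord) (simp_all add: coord_diag_op assms norm_mult mult_right_mono)
  qed (simp_all add: diag_op_def block_op_linear assms)
qed

lemma bounded_clinear_compose:
  "bounded_clinear F \<Longrightarrow> bounded_clinear G \<Longrightarrow> bounded_clinear (\<lambda>x. F (G x))"
  unfolding bounded_clinear_def using bounded_linear_compose by auto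

section \<open>Invertibility near diagonalized operators\<close>

text \<open>
  Solving \<open>S x = y\<close> means finding a fixed point of \<open>x \<mapsto> R (y - (S x - F x))\<close>, where \<open>R\<close> inverts \<open>F\<close>.
  As \<open>R\<close> has norm at most \<open>1 / d\<close>, this map is a contraction with factor \<open>q / d\<close>.
\<close>

lemma bounded_invertible_perturbation:
  assumes F: "bounded_clinear F" and R: "bounded_clinear R"
    and FR: "\<And>x. F (R x) = x" and RF: "\<And>x. R (F x) = x"
    and Rd: "\<And>x. d * norm (R x) \<le> norm x"
    and S: "bounded_clinear S" and q: "\<And>x. norm (S x - F x) \<le> q * norm x"
    and "0 \<le> q" "q < d"
  shows "bounded_invertible S"
proof -
  have d: "0 < d" using assms by linarith
  have Rd': "norm (R x) \<le> norm x / d" for x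
    using Rd[of x] d by (simp add: field_simps)
  have ex1: "\<exists>!x. S x = y" for y
  proof -
    let ?f = "\<lambda>x. R (y - (S x - F x))"
    have "dist (?f x) (?f z) \<le> q / d * dist x z" for x z
    proof -
      have "?f x - ?f z = R (- (S (x - z) - F (x - z)))"
        by (simp add: bounded_clinearD(4)[OF F] bounded_clinearD(4)[OF S] algebra_simps
            flip: bounded_clinearD(4)[OF R])
      then have "norm (?f x - ?f z) \<le> norm (S (x - z) - F (x - z)) / d"
        using Rd'[of "- (S (x - z) - F (x - z))"] by (simp only: norm_minus_cancel)
      also have "\<dots> \<le> q * norm (x - z) / d"
        using q d by (simp add: divide_right_mono)
      finally show ?thesis by (simp add: dist_norm)
    qed
    then have "\<exists>!x. ?f x = x"
      using banach_fix_type[of "q / d" ?f] assms d by simp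
    moreover have "?f x = x \<longleftrightarrow> S x = y" for x
    proof
      assume "?f x = x"
      then have "F (?f x) = F x" by simp
      then show "S x = y" by (simp add: FR)
    qed (simp add: RF)
    ultimately show ?thesis by simp
  qed
  define W where "W y = (THE x. S x = y)" for y
  have SW: "S (W y) = y" for y unfolding W_def by (rule theI'[OF ex1])
  have WS: "W (S x) = x" for x unfolding W_def by (rule the1_equality[OF ex1 refl])
  have below: "(d - q) * norm x \<le> norm (S x)" for x
  proof -
    have "d * norm x \<le> norm (F x)" using Rd[of "F x"] by (simp add: RF)
    also have "\<dots> \<le> norm (S x) + norm (S x - F x)"
      using norm_triangle_ineq4[of "S x" "S x - F x"] by simp
    finally show ?thesis using q[of x] by (simp add: algebra_simps)
  qed
  have "bounded_clinear W"
  proof (rule bounded_clinearI)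
    show "W (x + y) = W x + W y" for x y
      using WS[of "W x + W y"] by (simp add: SW bounded_clinearD(3)[OF S])
    show "W (c *\<^sub>C x) = c *\<^sub>C W x" for c x
      using WS[of "c *\<^sub>C W x"] by (simp add: SW bounded_clinearD(2)[OF S])
    show "norm (W x) \<le> 1 / (d - q) * norm x" for x
      using below[of "W x"] \<open>q < d\<close> by (simp add: SW field_simps)
  qed
  then show ?thesis
    unfolding bounded_invertible_def using SW WS by (intro exI[of _ W]) (auto simp: fun_eq_iff)
qed

text \<open>
  \<open>S\<close> is unitarily equivalent to multiplication by \<open>a\<close>, with \<open>V\<close> the inverse of the unitary \<open>U\<close>.
\<close>

definition diagonalized_by ::
  "(ell2 \<Rightarrow> ell2) \<Rightarrow> (nat \<Rightarrow> complex) \<Rightarrow> (ell2 \<Rightarrow> ell2) \<Rightarrow> (ell2 \<Rightarrow> ell2) \<Rightarrow> bool" where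
  "diagonalized_by S a U V \<longleftrightarrow> bounded (range a) \<and> bounded_clinear U \<and> bounded_clinear V
     \<and> (\<forall>x. U (V x) = x) \<and> (\<forall>x. V (U x) = x) \<and> (\<forall>x. norm (U x) = norm x)
     \<and> (\<forall>x. S x = U (diag_op a (V x)))"

lemma diagonalized_byD:
  assumes "diagonalized_by S a U V"
  shows "bounded (range a)" "bounded_clinear U" "bounded_clinear V" "U (V x) = x" "V (U x) = x"
    "norm (U x) = norm x" "norm (V x) = norm x" "S x = U (diag_op a (V x))"
proof -
  note D = assms[unfolded diagonalized_by_def]
  show "bounded (range a)" "bounded_clinear U" "bounded_clinear V" "U (V x) = x" "V (U x) = x"
    "norm (U x) = norm x" "S x = U (diag_op a (V x))"
    using D by simp_all
  have "\<forall>x. norm (U x) = norm x" and UV: "U (V x) = x" using D by simp_all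
  then have "norm (U (V x)) = norm (V x)" by (rule_tac spec)
  then show "norm (V x) = norm x" unfolding UV by simp
qed

lemma bounded_invertible_near_diagonalized:
  assumes F: "diagonalized_by F a U V" and a: "\<And>i. d \<le> cmod (a i)"
    and S: "bounded_clinear S" and q: "\<And>x. norm (S x - F x) \<le> q * norm x" "0 \<le> q" "q < d"
  shows "bounded_invertible S"
proof -
  note D = diagonalized_byD[OF F]
  have d: "0 < d" using q by linarith
  have an: "a i \<noteq> 0" for i using a[of i] d by auto
  have inv: "cmod (inverse (a i)) \<le> 1 / d" for i
    using a[of i] d by (simp add: norm_inverse divide_inverse le_imp_inverse_le)
  then have bi: "bounded (range (\<lambda>i. inverse (a i)))" unfolding bounded_iff by blast
  let ?R = "\<lambda>x. U (diag_op (\<lambda>i. inverse (a i)) (V x))"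
  have 1: "diag_op a (diag_op (\<lambda>i. inverse (a i)) x) = x"
    "diag_op (\<lambda>i. inverse (a i)) (diag_op a x) = x" for x
    by (rule ell2_eqI; simp add: coord_diag_op D(1) bi an)+
  show ?thesis
  proof (rule bounded_invertible_perturbation[of F ?R d S q])
    show "bounded_clinear F"
    proof -
      have "F = (\<lambda>x. U (diag_op a (V x)))" using D(8) by auto
      then show ?thesis
        using bounded_clinear_compose[OF D(2) bounded_clinear_compose[OF
            bounded_clinear_diag_op[OF D(1)] D(3)]] by (simp only:)
    qed
    show "bounded_clinear ?R"
      by (rule bounded_clinear_compose[OF D(2) bounded_clinear_compose[OF
            bounded_clinear_diag_op[OF bi] D(3)]])
    show "F (?R x) = x" "?R (F x) = x" for x by (simp_all add: D(4,5,8) 1)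
    show "d * norm (?R x) \<le> norm x" for x
    proof -
      have "norm (diag_op (\<lambda>i. inverse (a i)) (V x)) \<le> 1 / d * norm (V x)"
        using mult_right_mono[OF inv norm_ge_zero] d
        by (intro norm_le_by_coord) (simp_all add: coord_diag_op bi norm_mult)
      then show ?thesis using d by (simp add: D(6,7) field_simps)
    qed
  qed (use S q in auto)
qed

text \<open>
  Only the leading block has to be diagonalized: \<open>U\<close> and \<open>V\<close> act there by the orthogonal matrix of
  eigenvectors and its transpose, and as the identity on the tail.
\<close>

lemma diagonalized_by_orthonormal_eigenbasis:
  fixes lam :: "nat \<Rightarrow> real"
  assumes "A \<in> carrier_mat n n" "symmetric_mat A"
    and "inj_on lam {..<n}" "\<And>k. k < n \<Longrightarrow> eigenvalue A (lam k)"
    and "bounded (range lam)" "bounded_clinear S" "has_matrix S (extended_matrix n A lam)"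
  obtains U V where "diagonalized_by S (\<lambda>i. complex_of_real (lam i)) U V"
proof -
  from orthonormal_eigenbasis[OF assms(1-4)] obtain P where
    P1: "\<And>i k. i < n \<Longrightarrow> k < n \<Longrightarrow> (\<Sum>j<n. A $$ (i, j) * P j k) = lam k * P i k" and
    P2: "\<And>j k. j < n \<Longrightarrow> k < n \<Longrightarrow> (\<Sum>i<n. P i j * P i k) = (if j = k then 1 else 0)" and
    P3: "\<And>i j. i < n \<Longrightarrow> j < n \<Longrightarrow> (\<Sum>k<n. P i k * P j k) = (if i = j then 1 else 0)"
    by blast
  have b: "bounded (range (\<lambda>i. complex_of_real (lam i)))"
    using assms(5) by (simp add: bounded_iff)
  have b1: "bounded (range (\<lambda>i::nat. 1 :: complex))" by (simp add: image_constant_conv)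
  define U where "U = block_op n (\<lambda>i j. complex_of_real (P i j)) (\<lambda>_. 1)"
  define V where "V = block_op n (\<lambda>i j. complex_of_real (P j i)) (\<lambda>_. 1)"
  have prod: "block_op n M (\<lambda>_. 1) (block_op n N (\<lambda>_. 1) x) = x"
    if "\<And>i j. i < n \<Longrightarrow> j < n \<Longrightarrow> (\<Sum>k<n. M i k * N k j) = (if i = j then 1 else 0)"
    for M N :: "nat \<Rightarrow> nat \<Rightarrow> complex" and x
    by (rule ell2_eqI) (simp add: block_op_block_op b1 coord_block_op that mult_delta_left)
  have UV: "U (V x) = x" for x
    unfolding U_def V_def by (rule prod) (simp add: P3 flip: of_real_mult of_real_sum)
  have VU: "V (U x) = x" for x
    unfolding U_def V_def by (rule prod) (simp add: P2 flip: of_real_mult of_real_sum)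
  have adj: "inner (U x) y = inner x (V y)" "inner (V x) y = inner x (U y)" for x y
    by (simp_all add: U_def V_def inner_block_op b1)
  have nU: "norm (U x) = norm x" for x
    by (simp add: norm_eq_sqrt_inner adj VU)
  have nV: "norm (V x) = norm x" for x
    by (simp add: norm_eq_sqrt_inner adj UV)
  have SU: "S (U x) = U (diag_op (\<lambda>i. complex_of_real (lam i)) x)" for x
  proof -
    have "S (U x) = block_op n (\<lambda>i j. \<Sum>k<n. complex_of_real (A $$ (i, k)) * complex_of_real (P k j))
        (\<lambda>i. complex_of_real (lam i)) x"
      unfolding operator_eq_block_op[OF assms(6,7,5)] U_def block_op_block_op[OF b b1] by simp
    also have "\<dots> = block_op n (\<lambda>i j. complex_of_real (lam j) * complex_of_real (P i j))
        (\<lambda>i. complex_of_real (lam i)) x"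
      by (rule block_op_cong[OF b]) (simp add: P1 flip: of_real_mult of_real_sum)
    also have "\<dots> = U (diag_op (\<lambda>i. complex_of_real (lam i)) x)"
      unfolding U_def diag_op_eq_block_op[OF b, of _ n] block_op_block_op[OF b1 b] mult_1
      by (rule block_op_cong[OF b]) (simp add: mult_delta_right mult.commute)
    finally show ?thesis .
  qed
  have "diagonalized_by S (\<lambda>i. complex_of_real (lam i)) U V"
    unfolding diagonalized_by_def
  proof (intro conjI allI)
    show "bounded_clinear U"
      by (rule bounded_clinearI[where K = 1])
        (simp_all only: nU, simp_all add: U_def block_op_linear b1)
    show "bounded_clinear V"
      by (rule bounded_clinearI[where K = 1])
        (simp_all only: nV, simp_all add: V_def block_op_linear b1)
    show "S x = U (diag_op (\<lambda>i. complex_of_real (lam i)) (V x))" for x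
      using SU[of "V x"] by (simp add: UV)
  qed (fact b UV VU nU)+
  then show thesis by (rule that)
qed

section \<open>Norm limits of diagonalized operators\<close>

text \<open>
  What the argument keeps of a constructed solution \<open>T\<close>: approximants \<open>S n\<close> that are all unitarily
  equivalent to the same diagonal operator, and that act diagonally on vectors supported on
  the coordinates above \<open>n\<close>.
\<close>

locale norm_limit_of_diagonalized =
  fixes T :: "ell2 \<Rightarrow> ell2" and lam :: "nat \<Rightarrow> real"
    and S U V :: "nat \<Rightarrow> ell2 \<Rightarrow> ell2" and e :: "nat \<Rightarrow> real"
  assumes T: "bounded_clinear T"
    and diag: "\<And>n. diagonalized_by (S n) (\<lambda>i. complex_of_real (lam i)) (U n) (V n)"
    and sym: "\<And>n x y. inner (S n x) y = inner x (S n y)"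
    and tail: "\<And>n x i. (\<And>j. j \<le> n \<Longrightarrow> coord x j = 0) \<Longrightarrow> coord (S n x) i = lam i * coord x i"
    and err: "\<And>n x. norm (S n x - T x) \<le> e n * norm x"
    and e0: "\<And>n. 0 \<le> e n" and err_tendsto: "e \<longlonglongrightarrow> 0"

text \<open>
  The index of the approximants is moved by one, since the \<open>n\<close>-th one is constrained only for
  \<open>n \<ge> 1\<close>. Each \<open>n\<close> by \<open>n\<close> block has \<open>n\<close> distinct eigenvalues and is therefore diagonalizable with simple
  spectrum.
\<close>

lemma constructed_solution_norm_limit_of_diagonalized:
  assumes T: "constructed_solution E \<Lambda> lam T" and "bounded \<Lambda>"
  obtains S U V e where "norm_limit_of_diagonalized T lam S U V e"
proof -
  note T' = T[unfolded constructed_solution_def]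
  have inj: "inj lam" and "range lam \<subseteq> \<Lambda>" using T' by auto
  then have b: "bounded (range lam)" using assms(2) bounded_subset by blast
  have bc: "bounded (range (\<lambda>i. complex_of_real (lam i)))" using b by (simp add: bounded_iff)
  from T' obtain A Tn where
    A: "\<forall>n\<ge>1. A n \<in> carrier_mat n n \<and> symmetric_mat (A n) \<and>
           is_graph_of (induced_subgraph E {..<n}) (A n) \<and>
           spectrum (A n) = lam ` {..<n} \<and>
           WSP n (A n) \<and>
           (\<forall>i<n. \<forall>j<n. i \<noteq> j \<longrightarrow>
              A (Suc n) $$ (i, j) = direct_sum1 (A n) (lam n) $$ (i, j)) \<and>
           mat_op_norm (direct_sum1 (A n) (lam n) - A (Suc n)) < 1 / 2 ^ n" and
    Tn: "\<forall>n\<ge>1. bounded_clinear (Tn n) \<and> has_matrix (Tn n) (extended_matrix n (A n) lam)" and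
    Tb: "bounded_clinear T" and lim: "(\<lambda>n. onorm (\<lambda>x. Tn n x - T x)) \<longlonglongrightarrow> 0"
    by (elim conjE exE) (rule that)
  have A1: "A (Suc n) \<in> carrier_mat (Suc n) (Suc n)" "symmetric_mat (A (Suc n))"
    "spectrum (A (Suc n)) = lam ` {..<Suc n}" for n
    using A by auto
  have ev: "eigenvalue (A (Suc n)) (lam k)" if "k < Suc n" for n k
  proof -
    have "lam k \<in> spectrum (A (Suc n))" unfolding A1(3) using that by simp
    then show ?thesis by (simp add: spectrum_def)
  qed
  have S1: "bounded_clinear (Tn (Suc n))"
    "has_matrix (Tn (Suc n)) (extended_matrix (Suc n) (A (Suc n)) lam)" for n
    using Tn by auto
  have "\<exists>U V. diagonalized_by (Tn (Suc n)) (\<lambda>i. complex_of_real (lam i)) U V" for n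
    using diagonalized_by_orthonormal_eigenbasis[OF A1(1,2) inj_on_subset[OF inj subset_UNIV] ev b S1]
    by blast
  then obtain U V where UV:
    "\<And>n. diagonalized_by (Tn (Suc n)) (\<lambda>i. complex_of_real (lam i)) (U n) (V n)"
    by metis
  note S = operator_eq_block_op[OF S1 b]
  have symA: "A (Suc n) $$ (j, i) = A (Suc n) $$ (i, j)" if "i < Suc n" "j < Suc n" for i j n
    using A1(1,2) that unfolding symmetric_mat_def by (metis carrier_matD index_transpose_mat(1))
  have 2: "inner (Tn (Suc n) x) y = inner x (Tn (Suc n) y)" for n x y
    unfolding S inner_block_op[OF bc]
    by (simp only: complex_cnj_complex_of_real)
      (subst block_op_cong[OF bc], simp_all only: symA)
  have 3: "coord (Tn (Suc n) x) i = lam i * coord x i"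
    if x: "\<And>j. j \<le> n \<Longrightarrow> coord x j = 0" for n x i
    unfolding S coord_block_op[OF bc] using x by auto
  have bl: "bounded_linear (\<lambda>x. Tn (Suc n) x - T x)" for n
    by (intro bounded_linear_sub bounded_clinearD(1) S1 Tb)
  have "norm_limit_of_diagonalized T lam (\<lambda>n. Tn (Suc n)) U V (\<lambda>n. onorm (\<lambda>x. Tn (Suc n) x - T x))"
    by (unfold_locales)
      (fact Tb UV 2 3 onorm[OF bl] onorm_pos_le[OF bl] LIMSEQ_Suc[OF lim])+
  then show thesis by (rule that)
qed

text \<open>
  The functional \<open>x \<mapsto> coord (V x) k\<close> is the inner product with the \<open>k\<close>-th eigenvector \<open>U (ket k)\<close>. Adding
  \<open>c\<close> times the projection onto that vector moves the \<open>k\<close>-th eigenvalue only; this is how a zero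
  eigenvalue of \<open>S - \<mu>\<close> is removed without losing diagonality.
\<close>

lemma diagonalized_by_shifted:
  assumes "diagonalized_by S a U V"
  shows "diagonalized_by (\<lambda>x. shifted S \<mu> x + (c * coord (V x) k) *\<^sub>C U (ket k))
    (\<lambda>i. a i - \<mu> + (if i = k then c else 0)) U V"
proof -
  note D = diagonalized_byD[OF assms]
  define b where "b i = a i - \<mu> + (if i = k then c else 0)" for i
  obtain K where K: "\<And>i. cmod (a i) \<le> K" using D(1) by (auto simp: bounded_iff)
  have "cmod (b i) \<le> K + cmod \<mu> + cmod c" for i
  proof -
    have "cmod (if i = k then c else 0) \<le> cmod c" by simp
    then show ?thesis
      using K[of i] norm_triangle_ineq4[of "a i" \<mu>]
        norm_triangle_ineq[of "a i - \<mu>" "if i = k then c else 0"]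
      unfolding b_def by linarith
  qed
  then have bb: "bounded (range b)" unfolding bounded_iff by blast
  have "diag_op b x = diag_op a x - \<mu> *\<^sub>C x + (c * coord x k) *\<^sub>C ket k" for x
    by (rule ell2_eqI) (simp add: coord_diag_op[OF bb] coord_diag_op[OF D(1)] b_def algebra_simps)
  then have "U (diag_op b (V x)) = shifted S \<mu> x + (c * coord (V x) k) *\<^sub>C U (ket k)" for x
    by (simp add: bounded_clinearD(2,3,4)[OF D(2)] D(4) D(8) shifted_def)
  then show ?thesis
    unfolding diagonalized_by_def b_def[symmetric] using D(2-6) bb by simp
qed

section \<open>Kernel and range of a singular rank-one perturbation\<close>

text \<open>
  Let \<open>R\<close> invert \<open>F + \<phi> u\<close> and put \<open>v = R u\<close>. Then \<open>R (F x) = x - \<phi> x v\<close>, so the kernel lies in the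
  line through \<open>v\<close>, and \<open>v\<close> belongs to it exactly when \<open>\<phi> v = 1\<close>. If \<open>\<phi> v\<close> were not \<open>1\<close>, applying \<open>\<phi>\<close>
  would bound \<open>\<phi> x\<close>, and then \<open>x\<close>, by a multiple of \<open>F x\<close>, which the approximate kernel vectors
  exclude. With \<open>\<phi> v = 1\<close>, the range is the kernel of the continuous functional \<open>\<phi> \<circ> R\<close>, hence
  closed, and \<open>u\<close> spans a complement.
\<close>

lemma rank_one_perturbation_kernel_fredholm:
  assumes F: "bounded_clinear F" and inv: "bounded_invertible (\<lambda>x. F x + \<phi> x *\<^sub>C u)"
    and \<phi>: "\<And>x y. \<phi> (x + y) = \<phi> x + \<phi> y" "\<And>c x. \<phi> (c *\<^sub>C x) = c * \<phi> x"
      "\<And>x. cmod (\<phi> x) \<le> K * norm x" and u: "u \<noteq> 0"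
    and ap: "\<And>\<epsilon>. 0 < \<epsilon> \<Longrightarrow> \<exists>x. norm x = 1 \<and> norm (F x) < \<epsilon>"
  shows "\<exists>v. v \<noteq> 0 \<and> op_kernel F = cell2.span {v}" "fredholm F"
proof -
  let ?G = "\<lambda>x. F x + \<phi> x *\<^sub>C u"
  from inv obtain R where R: "bounded_clinear R" "R \<circ> ?G = id" "?G \<circ> R = id"
    unfolding bounded_invertible_def by blast
  have RG: "R (?G x) = x" for x using fun_cong[OF R(2), of x] by simp
  have GR: "?G (R y) = y" for y using fun_cong[OF R(3), of y] by simp
  note RD = bounded_clinearD[OF R(1)] and FD = bounded_clinearD[OF F]
  define v where "v = R u"
  have RF: "R (F x) = x - \<phi> x *\<^sub>C v" for x
  proof -
    have "R (F x) + \<phi> x *\<^sub>C v = R (?G x)" by (simp add: v_def RD(2,3))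
    then show ?thesis unfolding RG by (simp add: algebra_simps)
  qed
  have FR: "F (R y) = y - \<phi> (R y) *\<^sub>C u" for y
    using GR[of y] by (simp add: algebra_simps)
  have \<phi>m: "\<phi> (x - y) = \<phi> x - \<phi> y" for x y
    using \<phi>(1)[of "x - y" y] by (simp add: algebra_simps)
  have R0: "R y = 0 \<Longrightarrow> y = 0" for y
    using GR[of y] \<phi>(2)[of 0 0] by (simp add: FD(5))
  have v0: "v \<noteq> 0" using R0[of u] u by (auto simp: v_def)
  have one: "\<phi> v = 1"
  proof (rule ccontr)
    assume ne: "\<phi> v \<noteq> 1"
    define c where "c = cmod (1 - \<phi> v)"
    have c: "0 < c" using ne by (simp add: c_def)
    define L where "L = onorm R"
    have L: "norm (R y) \<le> L * norm y" "0 \<le> L" for y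
      unfolding L_def by (rule onorm[OF RD(1)], rule onorm_pos_le[OF RD(1)])
    have K: "0 \<le> K"
      using \<phi>(3)[of "ket 0"] norm_ge_zero[of "\<phi> (ket 0)"] by (simp del: norm_ge_zero)
    have est: "norm x \<le> (L + K * L / c * norm v) * norm (F x)" for x
    proof -
      have "\<phi> (R (F x)) = \<phi> x * (1 - \<phi> v)"
        by (simp add: RF \<phi>m \<phi>(2) algebra_simps)
      then have "cmod (\<phi> x) * c \<le> K * norm (R (F x))"
        using \<phi>(3)[of "R (F x)"] by (simp add: c_def norm_mult)
      also have "\<dots> \<le> K * (L * norm (F x))"
        using L K by (intro mult_left_mono)
      finally have 1: "cmod (\<phi> x) \<le> K * L / c * norm (F x)"
        using c by (simp add: field_simps)
      have "norm x \<le> norm (R (F x)) + norm (\<phi> x *\<^sub>C v)"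
        using norm_triangle_ineq[of "R (F x)" "\<phi> x *\<^sub>C v"] by (simp add: RF)
      also have "\<dots> \<le> L * norm (F x) + K * L / c * norm (F x) * norm v"
        unfolding norm_scaleC using L(1)[of "F x"] mult_right_mono[OF 1 norm_ge_zero[of v]] by linarith
      finally show ?thesis by (simp add: algebra_simps)
    qed
    define M where "M = L + K * L / c * norm v"
    have M: "0 \<le> M" using L K c by (simp add: M_def)
    obtain x where x: "norm x = 1" "norm (F x) < 1 / (M + 1)"
      using ap[of "1 / (M + 1)"] M by auto
    have "1 \<le> M * norm (F x)" using est[of x] x by (simp add: M_def)
    also have "\<dots> \<le> M * (1 / (M + 1))" using x M by (intro mult_left_mono) auto
    also have "\<dots> < 1" using M by simp
    finally show False by simp
  qed
  have ker: "op_kernel F = cell2.span {v}"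
  proof (rule Set.set_eqI)
    fix x
    have "F v = 0" using FR[of u] one by (simp add: v_def)
    then have "F (c *\<^sub>C v) = 0" for c by (simp add: FD(2))
    moreover have "x = \<phi> x *\<^sub>C v" if "F x = 0"
      using RF[of x] that by (simp add: RD(5))
    ultimately show "x \<in> op_kernel F \<longleftrightarrow> x \<in> cell2.span {v}"
      unfolding op_kernel_def cell2.span_singleton by auto
  qed
  then show "\<exists>v. v \<noteq> 0 \<and> op_kernel F = cell2.span {v}" using v0 by blast
  have rg: "range F = {y. \<phi> (R y) = 0}"
  proof (intro Set.set_eqI iffI)
    fix y assume "y \<in> range F"
    then show "y \<in> {y. \<phi> (R y) = 0}" by (auto simp: RF \<phi>m \<phi>(2) one)
  next
    fix y assume "y \<in> {y. \<phi> (R y) = 0}"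
    then have "F (R y) = y" by (simp add: FR)
    then show "y \<in> range F" by (metis rangeI)
  qed
  have "bounded_linear \<phi>"
    using \<phi> by (intro bounded_linear_intro[where K = K])
      (auto simp: scaleR_ell2_conv_scaleC scaleR_conv_of_real mult.commute)
  then have "bounded_linear (\<lambda>y. \<phi> (R y))"
    using bounded_linear_compose RD(1) by blast
  then have "closed (range F)"
    unfolding rg by (intro closed_Collect_eq linear_continuous_on continuous_on_const)
  moreover have "y \<in> cell2.span (range F \<union> {u})" for y
  proof -
    have "y = F (R y) + \<phi> (R y) *\<^sub>C u" by (simp add: FR)
    moreover have "F (R y) \<in> cell2.span (range F \<union> {u})" by (intro cell2.span_base) simp
    moreover have "\<phi> (R y) *\<^sub>C u \<in> cell2.span (range F \<union> {u})"
      by (intro cell2.span_scale cell2.span_base) simp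
    ultimately show ?thesis by (metis cell2.span_add)
  qed
  ultimately show "fredholm F"
    unfolding fredholm_def ker using F by (intro conjI exI[of _ "{v}"] exI[of _ "{u}"]) auto
qed

lemma bounded_invertible_imp_fredholm:
  assumes F: "bounded_clinear F" and "bounded_invertible F" shows "fredholm F"
proof -
  obtain R where R: "bounded_clinear R" "R \<circ> F = id" "F \<circ> R = id"
    using assms unfolding bounded_invertible_def by blast
  have "x = 0" if "F x = 0" for x
    using fun_cong[OF R(2), of x] that bounded_clinearD(5)[OF R(1)] by simp
  then have "op_kernel F \<subseteq> cell2.span {}" by (auto simp: op_kernel_def)
  moreover have "range F = UNIV" using fun_cong[OF R(3)] by (metis comp_apply id_apply surjI)
  ultimately show ?thesis
    unfolding fredholm_def using F by (intro conjI exI[of _ "{}"]) auto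
qed

section \<open>Symmetric operators with a large approximate kernel\<close>

instance ell2 :: banach ..

text \<open>
  The dimension count "more unknowns than equations", in a form that needs no dimension: each
  further condition costs one index. A solution for \<open>C\<close> on \<open>J\<close> and a second one on \<open>J\<close> without
  some index of the support of the first are linearly independent, and one condition more
  leaves a nonzero combination of the two.
\<close>

lemma exists_supported_orthogonal:
  fixes C :: "ell2 set"
  assumes "finite C" "infinite J"
  shows "\<exists>x. x \<noteq> 0 \<and> (\<forall>i. i \<notin> J \<longrightarrow> coord x i = 0) \<and> (\<forall>c\<in>C. inner x c = 0)"
  using assms
proof (induction C arbitrary: J rule: finite_induct)
  case empty
  then obtain j where "j \<in> J" by (metis finite.emptyI ex_in_conv)
  then show ?case
    by (intro exI[of _ "ket j"]) (use norm_ket[of j] in \<open>auto simp del: norm_ket\<close>)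
next
  case (insert c C)
  obtain x where x: "x \<noteq> 0" "\<forall>i. i \<notin> J \<longrightarrow> coord x i = 0" "\<forall>b\<in>C. inner x b = 0"
    using insert.IH[OF insert.prems] by blast
  obtain i0 where i0: "coord x i0 \<noteq> 0" using x(1) ell2_eqI[of x 0] by auto
  obtain y where y: "y \<noteq> 0" "\<forall>i. i \<notin> J - {i0} \<longrightarrow> coord y i = 0" "\<forall>b\<in>C. inner y b = 0"
    using insert.IH[of "J - {i0}"] insert.prems by auto
  show ?case
  proof (cases "inner y c = 0")
    case True
    then show ?thesis using y by (intro exI[of _ y]) auto
  next
    case False
    let ?z = "inner y c *\<^sub>R x - inner x c *\<^sub>R y"
    have "coord ?z i0 \<noteq> 0" using False i0 y(2) by simp
    then have "?z \<noteq> 0" by (auto simp del: coord_simps simp: zero_ell2.rep_eq)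
    moreover have "\<forall>i. i \<notin> J \<longrightarrow> coord ?z i = 0" using x(2) y(2) by simp
    moreover have "\<forall>b\<in>insert c C. inner ?z b = 0"
      using x(3) y(3) by (auto simp: inner_diff_left)
    ultimately show ?thesis by blast
  qed
qed

lemma inner_scaleC_right:
  "inner x (c *\<^sub>C y) = Re c * inner x y + Im c * inner x (\<i> *\<^sub>C y)"
proof -
  have "c *\<^sub>C y = Re c *\<^sub>R y + Im c *\<^sub>R (\<i> *\<^sub>C y)"
    by (rule ell2_eqI) (simp add: complex_eq_iff)
  then show ?thesis by (simp add: inner_add_right)
qed

text \<open>
  Let \<open>B\<close> be a finite set that spans the whole space together with the range. Choose inductively an
  orthonormal sequence \<open>f n\<close>, orthogonal to \<open>B\<close>, with \<open>F (f n)\<close> of norm at most \<open>1 / 4 ^ n\<close>. The vector \<open>y\<close> with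
  coefficients \<open>1 / 2 ^ n\<close> in this sequence would be \<open>F w + b\<close> with \<open>b\<close> in the span of \<open>B\<close>; pairing with \<open>f n\<close>
  gives \<open>1 / 2 ^ n \<le> norm w / 4 ^ n\<close> by symmetry, for all \<open>n\<close>.
\<close>

lemma not_fredholm_if_symmetric_approximate_kernel:
  assumes sym: "\<And>x y. inner (F x) y = inner x (F y)"
    and ap: "\<And>C \<epsilon>. finite C \<Longrightarrow> 0 < \<epsilon> \<Longrightarrow>
      \<exists>x. norm x = 1 \<and> norm (F x) \<le> \<epsilon> \<and> (\<forall>c\<in>C. inner x c = 0)"
  shows "\<not> fredholm F"
proof
  assume fr: "fredholm F"
  then obtain B where B: "finite B" "cell2.span (range F \<union> B) = UNIV" and F: "bounded_clinear F"
    unfolding fredholm_def by blast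
  note FD = bounded_clinearD[OF F]
  \<comment> \<open>The inner product is only the real part of the Hermitian one; orthogonality to the complex
    span of \<open>B\<close> is real orthogonality to \<open>B\<close> and \<open>\<i> B\<close>.\<close>
  define D where "D = B \<union> scaleC \<i> ` B"
  have D: "finite D" using B by (simp add: D_def)
  have "\<exists>f. \<forall>n::nat. norm (f n) = 1 \<and> norm (F (f n)) \<le> 1 / 4 ^ n
      \<and> (\<forall>c\<in>D \<union> f ` {..<n}. inner (f n) c = 0)"
  proof (rule dependent_wellorder_choice)
    fix n :: nat and f :: "nat \<Rightarrow> ell2"
    show "\<exists>r. norm r = 1 \<and> norm (F r) \<le> 1 / 4 ^ n \<and> (\<forall>c\<in>D \<union> f ` {..<n}. inner r c = 0)"
      using D by (intro ap) auto
  next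
    fix r :: ell2 and f g :: "nat \<Rightarrow> ell2" and n :: nat
    assume "\<And>m. m < n \<Longrightarrow> f m = g m"
    then have "f ` {..<n} = g ` {..<n}" by (intro image_cong) auto
    then show "(norm r = 1 \<and> norm (F r) \<le> 1 / 4 ^ n \<and> (\<forall>c\<in>D \<union> f ` {..<n}. inner r c = 0))
      = (norm r = 1 \<and> norm (F r) \<le> 1 / 4 ^ n \<and> (\<forall>c\<in>D \<union> g ` {..<n}. inner r c = 0))" by simp
  qed
  then obtain f where "\<forall>n::nat. norm (f n) = 1 \<and> norm (F (f n)) \<le> 1 / 4 ^ n
      \<and> (\<forall>c\<in>D \<union> f ` {..<n}. inner (f n) c = 0)" ..
  then have f: "norm (f n) = 1" "norm (F (f n)) \<le> 1 / 4 ^ n"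
    "c \<in> D \<Longrightarrow> inner (f n) c = 0" "m < n \<Longrightarrow> inner (f n) (f m) = 0" for n m c
    by auto
  have orth: "inner (f m) (f n) = (if n = m then 1 else 0)" for m n
    using f(1)[of m] f(4)[of m n] f(4)[of n m]
    by (cases m n rule: linorder_cases) (auto simp: inner_commute norm_eq_1)
  have "summable (\<lambda>n. norm ((1/2) ^ n *\<^sub>R f n))"
    by (simp add: f(1) summable_geometric)
  then have sm: "summable (\<lambda>n. (1/2) ^ n *\<^sub>R f n)" by (rule summable_norm_cancel)
  define y where "y = (\<Sum>n. (1/2) ^ n *\<^sub>R f n)"
  have iy: "inner (f m) y = (1/2) ^ m" for m
  proof -
    have "inner (f m) y = (\<Sum>n. inner (f m) ((1/2) ^ n *\<^sub>R f n))"
      unfolding y_def by (rule bounded_linear.suminf[OF bounded_linear_inner_right sm])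
    also have "\<dots> = (\<Sum>n\<in>{m}. inner (f m) ((1/2) ^ n *\<^sub>R f n))"
      by (rule suminf_finite) (auto simp: orth)
    finally show ?thesis by (simp add: orth)
  qed
  have rg: "cell2.span (range F) = range F"
  proof (rule cell2.span_eq_iff[THEN iffD2], rule cell2.subspaceI)
    show "0 \<in> range F" using rangeI[of F 0] by (simp add: FD(5))
    show "x + z \<in> range F" if "x \<in> range F" "z \<in> range F" for x z
      using that by (auto simp flip: FD(3))
    show "c *\<^sub>C x \<in> range F" if "x \<in> range F" for c x
      using that by (auto simp flip: FD(2))
  qed
  have "y \<in> cell2.span (range F \<union> B)" using B by simp
  then obtain w b where w: "y = F w + b" and b: "b \<in> cell2.span B"
    unfolding cell2.span_Un rg by blast
  have "\<forall>c. inner (f m) (c *\<^sub>C b) = 0" for m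
    using b
  proof (induction rule: cell2.span_induct)
    case base
    show "cell2.subspace {b. \<forall>c. inner (f m) (c *\<^sub>C b) = 0}"
      by (rule cell2.subspaceI) (auto simp: cell2.scale_right_distrib inner_add_right)
  next
    case (step b)
    then have "b \<in> D" "\<i> *\<^sub>C b \<in> D" by (auto simp: D_def)
    then show ?case by (intro allI, subst inner_scaleC_right) (simp add: f(3))
  qed
  then have "inner (f m) (1 *\<^sub>C b) = 0" for m by blast
  then have fb: "inner (f m) b = 0" for m by simp
  have "2 ^ m \<le> norm w" for m :: nat
  proof -
    have "(1/2) ^ m = inner (F (f m)) w"
      unfolding iy[symmetric] by (simp add: w inner_add_right fb sym)
    also have "\<dots> \<le> norm (F (f m)) * norm w" by (rule norm_cauchy_schwarz)
    also have "\<dots> \<le> 1 / 4 ^ m * norm w" using f(2) by (intro mult_right_mono) auto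
    finally have "(4::real) ^ m * (1/2) ^ m \<le> norm w" by (simp add: field_simps)
    then show ?thesis by (simp flip: power_mult_distrib)
  qed
  moreover obtain m where "norm w < 2 ^ m" using real_arch_pow[of 2 "norm w"] by auto
  ultimately show False by (meson not_less)
qed

section \<open>The spectrum of the limit operator\<close>

context norm_limit_of_diagonalized
begin

lemma err_small: "0 < \<epsilon> \<Longrightarrow> \<exists>n. e n < \<epsilon>"
  by (rule eventually_happens'[OF sequentially_bot order_tendstoD(2)[OF err_tendsto]])

lemma shifted_err: "norm (shifted T \<mu> x - shifted (S n) \<mu> x) \<le> e n * norm x"
  using err[of n x] by (simp add: shifted_def norm_minus_commute)

lemma not_in_spectrum:
  assumes "0 < d" "\<And>i. d \<le> cmod (complex_of_real (lam i) - \<mu>)"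
  shows "bounded_invertible (shifted T \<mu>)"
proof -
  obtain n where n: "e n < d" using err_small assms(1) by blast
  have "diagonalized_by (shifted (S n) \<mu>) (\<lambda>i. complex_of_real (lam i) - \<mu>) (U n) (V n)"
    using diagonalized_by_shifted[OF diag, where c = 0] by simp
  then show ?thesis
    by (rule bounded_invertible_near_diagonalized[where d = d and q = "e n"])
      (use assms n e0 shifted_err bounded_clinear_shifted[OF T] in simp_all)
qed

text \<open>
  For \<open>N\<close> large, adding \<open>d\<close> times the spectral projection of \<open>S N\<close> for the eigenvalue \<open>lam k\<close> to
  \<open>T - lam k\<close> gives an operator close to an invertible diagonal one. The unit eigenvectors of the
  \<open>S n\<close> for the same eigenvalue provide the approximate kernel vectors.
\<close>

lemma isolated_point:
  assumes "0 < d" "\<And>i. i \<noteq> k \<Longrightarrow> d \<le> \<bar>lam i - lam k\<bar>"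
  shows "\<exists>v. v \<noteq> 0 \<and> op_kernel (shifted T (lam k)) = cell2.span {v}"
    and "fredholm (shifted T (lam k))"
proof -
  let ?\<mu> = "complex_of_real (lam k)"
  let ?F = "shifted T ?\<mu>"
  obtain N where N: "e N < d" using err_small assms(1) by blast
  define u where "u = U N (ket k)"
  define \<phi> where "\<phi> x = d * coord (V N x) k" for x
  note D = diagonalized_byD[OF diag]
  have gap: "d \<le> cmod (complex_of_real (lam i) - ?\<mu> + (if i = k then complex_of_real d else 0))" for i
  proof (cases "i = k")
    case False
    have "cmod (complex_of_real (lam i) - ?\<mu>) = \<bar>lam i - lam k\<bar>"
      by (metis norm_of_real of_real_diff real_norm_def)
    then show ?thesis using assms(2)[OF False] False by simp
  qed (use assms(1) in simp)
  have lin: "\<phi> (x + y) = \<phi> x + \<phi> y" "\<phi> (c *\<^sub>C x) = c * \<phi> x" for x y c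
    by (simp_all add: \<phi>_def bounded_clinearD[OF D(3)] algebra_simps)
  have bd: "cmod (\<phi> x) \<le> d * norm x" for x
    using norm_coord_le[of "V N x" k] assms(1) by (simp add: \<phi>_def norm_mult D(7))
  have G: "bounded_clinear (\<lambda>x. ?F x + \<phi> x *\<^sub>C u)"
  proof (rule bounded_clinearI)
    note F = bounded_clinear_shifted[OF T, of ?\<mu>]
    show "norm (?F x + \<phi> x *\<^sub>C u) \<le> (onorm ?F + d) * norm x" for x
      using norm_triangle_ineq[of "?F x" "\<phi> x *\<^sub>C u"] onorm[OF bounded_clinearD(1)[OF F], of x] bd[of x]
      by (simp add: norm_scaleC u_def D(6) algebra_simps)
  qed (simp_all add: lin bounded_clinearD(2,3)[OF bounded_clinear_shifted[OF T]]
      cell2.scale_left_distrib cell2.scale_right_distrib)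
  have inv: "bounded_invertible (\<lambda>x. ?F x + \<phi> x *\<^sub>C u)"
    by (rule bounded_invertible_near_diagonalized[OF diagonalized_by_shifted[OF diag[of N]] gap G])
      (use e0 shifted_err N in \<open>simp_all add: \<phi>_def u_def\<close>)
  have "\<exists>x. norm x = 1 \<and> norm (?F x) < \<epsilon>" if \<epsilon>: "0 < \<epsilon>" for \<epsilon>
  proof -
    obtain n where n: "e n < \<epsilon>" using err_small[OF \<epsilon>] by blast
    define w where "w = U n (ket k)"
    have "diag_op (\<lambda>i. complex_of_real (lam i)) (ket k) = ?\<mu> *\<^sub>C ket k"
      by (rule ell2_eqI) (simp add: coord_diag_op[OF D(1)])
    then have "S n w = ?\<mu> *\<^sub>C w"
      by (simp add: w_def D(5) D(8)[of n] bounded_clinearD(2)[OF D(2)])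
    then have "norm (?F w) = norm (S n w - T w)"
      by (simp add: shifted_def norm_minus_commute)
    then show ?thesis
      using err[of n w] n by (intro exI[of _ w]) (simp add: w_def D(6))
  qed
  note * = rank_one_perturbation_kernel_fredholm[OF bounded_clinear_shifted[OF T] inv lin bd _ this]
  have "u \<noteq> 0" using D(6)[of N "ket k"] by (auto simp: u_def)
  then show "\<exists>v. v \<noteq> 0 \<and> op_kernel ?F = cell2.span {v}" "fredholm ?F"
    using * by blast+
qed

lemma symmetric: "inner (T x) y = inner x (T y)"
proof -
  have lim: "(\<lambda>n. S n z) \<longlonglongrightarrow> T z" for z
  proof (rule LIM_zero_cancel[OF tendsto_norm_zero_cancel])
    show "(\<lambda>n. norm (S n z - T z)) \<longlonglongrightarrow> 0"
      by (rule tendsto_sandwich[of "\<lambda>_. 0" _ _ "\<lambda>n. e n * norm z"])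
        (use err tendsto_mult_right[OF err_tendsto, of "norm z"] in auto)
  qed
  have "(\<lambda>n. inner (S n x) y) \<longlonglongrightarrow> inner (T x) y" by (intro tendsto_intros lim)
  moreover have "(\<lambda>n. inner (S n x) y) \<longlonglongrightarrow> inner x (T y)"
    unfolding sym by (intro tendsto_intros lim)
  ultimately show ?thesis by (rule LIMSEQ_unique)
qed

text \<open>
  Infinitely many \<open>lam j\<close> lie near \<open>\<nu>\<close>. Vectors supported on such indices \<open>j > n\<close> are almost
  annihilated by \<open>S n - \<nu>\<close>, hence by \<open>T - \<nu>\<close>, and enough of them are available to meet any finite
  number of orthogonality conditions.
\<close>

lemma limit_point:
  assumes "\<nu> islimpt range lam"
  shows "\<not> fredholm (shifted T (complex_of_real \<nu>))"
proof (rule not_fredholm_if_symmetric_approximate_kernel)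
  let ?F = "shifted T (complex_of_real \<nu>)"
  show "inner (?F x) y = inner x (?F y)" for x y
    by (simp add: shifted_def inner_diff_left inner_diff_right symmetric inner_scaleC_left)
  fix C :: "ell2 set" and \<epsilon> :: real
  assume C: "finite C" and \<epsilon>: "0 < \<epsilon>"
  obtain n where n: "e n < \<epsilon> / 2" using err_small[of "\<epsilon> / 2"] \<epsilon> by auto
  define J where "J = {j. \<bar>lam j - \<nu>\<bar> < \<epsilon> / 2} - {..n}"
  have "infinite (range lam \<inter> ball \<nu> (\<epsilon> / 2))"
    using assms \<epsilon> unfolding islimpt_eq_infinite_ball by simp
  moreover have "range lam \<inter> ball \<nu> (\<epsilon> / 2) = lam ` {j. \<bar>lam j - \<nu>\<bar> < \<epsilon> / 2}"
    by (auto simp: dist_real_def abs_minus_commute)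
  ultimately have "infinite {j. \<bar>lam j - \<nu>\<bar> < \<epsilon> / 2}" by auto
  then have J: "infinite J" unfolding J_def by (simp add: Diff_infinite_finite)
  obtain z where z: "z \<noteq> 0" "\<forall>i. i \<notin> J \<longrightarrow> coord z i = 0" "\<forall>c\<in>C. inner z c = 0"
    using exists_supported_orthogonal[OF C J] by (elim exE conjE) (rule that)
  define x where "x = (1 / norm z) *\<^sub>R z"
  have x: "norm x = 1" "\<And>i. i \<notin> J \<Longrightarrow> coord x i = 0" "\<And>c. c \<in> C \<Longrightarrow> inner x c = 0"
    using z by (simp_all add: x_def)
  have Sx: "coord (S n x) i = lam i * coord x i" for i
    by (rule tail) (use x(2) in \<open>simp add: J_def\<close>)
  have "cmod (coord (shifted (S n) (complex_of_real \<nu>) x) i) \<le> \<epsilon> / 2 * cmod (coord x i)" for i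
  proof (cases "i \<in> J")
    case True
    then have "\<bar>lam i - \<nu>\<bar> \<le> \<epsilon> / 2" by (simp add: J_def)
    moreover have "coord (shifted (S n) (complex_of_real \<nu>) x) i = complex_of_real (lam i - \<nu>) * coord x i"
      by (simp add: shifted_def Sx algebra_simps)
    ultimately show ?thesis by (simp only: norm_mult norm_of_real mult_right_mono norm_ge_zero)
  qed (simp add: shifted_def Sx x(2))
  then have "norm (shifted (S n) (complex_of_real \<nu>) x) \<le> \<epsilon> / 2"
    using norm_le_by_coord[of "shifted (S n) (complex_of_real \<nu>) x" "\<epsilon> / 2" x] x(1) \<epsilon> by simp
  moreover have "norm (?F x - shifted (S n) (complex_of_real \<nu>) x) \<le> e n"
    using shifted_err[of "complex_of_real \<nu>" x n] x(1) by simp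
  ultimately have "norm (?F x) \<le> \<epsilon>"
    using n norm_triangle_ineq[of "?F x - shifted (S n) (complex_of_real \<nu>) x"
        "shifted (S n) (complex_of_real \<nu>) x"] by simp
  then show "\<exists>x. norm x = 1 \<and> norm (?F x) \<le> \<epsilon> \<and> (\<forall>c\<in>C. inner x c = 0)"
    using x by blast
qed

end

section \<open>Isolated eigenvalues are simple\<close>

theorem mainTheorem4:
  fixes E :: "nat \<Rightarrow> nat \<Rightarrow> bool" and \<Lambda> :: "real set"
    and lam :: "nat \<Rightarrow> real" and T :: "ell2 \<Rightarrow> ell2"
  assumes "symp E" and "irreflp E"
    and "compact \<Lambda>" and "infinite \<Lambda>"
    and "constructed_solution E \<Lambda> lam T"
  shows "(\<forall>\<mu>. isolated_eigenvalue T \<mu> \<longrightarrow> cell2.dim (op_kernel (shifted T \<mu>)) = 1)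
    \<and> op_spectrum T - ess_spectrum T = complex_of_real ` (\<Lambda> - {x. x islimpt \<Lambda>})
    \<and> (\<forall>\<mu>\<in>op_spectrum T - ess_spectrum T. cell2.dim (op_kernel (shifted T \<mu>)) = 1)"
proof -
  note cs = assms(5)[unfolded constructed_solution_def]
  have inj: "inj lam" and sub: "range lam \<subseteq> \<Lambda>" and dense: "\<Lambda> \<subseteq> closure (range lam)"
    using cs by simp_all
  obtain S U V e where "norm_limit_of_diagonalized T lam S U V e"
    using constructed_solution_norm_limit_of_diagonalized[OF assms(5) compact_imp_bounded[OF assms(3)]] .
  then interpret norm_limit_of_diagonalized T lam S U V e .
  have off: "bounded_invertible (shifted T \<mu>)" if \<mu>: "\<mu> \<notin> complex_of_real ` \<Lambda>" for \<mu>
  proof -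
    have cl: "closed (complex_of_real ` \<Lambda>)"
      by (intro compact_imp_closed compact_continuous_image continuous_intros assms)
    obtain d where d: "0 < d" "\<forall>x\<in>complex_of_real ` \<Lambda>. d \<le> dist \<mu> x"
      using separate_point_closed[OF cl \<mu>] by (elim exE conjE) (rule that)
    show ?thesis
    proof (rule not_in_spectrum[OF d(1)])
      fix i
      have "complex_of_real (lam i) \<in> complex_of_real ` \<Lambda>" using sub by auto
      from bspec[OF d(2) this] show "d \<le> cmod (complex_of_real (lam i) - \<mu>)"
        by (simp add: dist_norm norm_minus_commute)
    qed
  qed
  have lim: "\<not> fredholm (shifted T (complex_of_real \<nu>))" if "\<nu> islimpt \<Lambda>" for \<nu>
  proof (rule limit_point)
    show "\<nu> islimpt range lam"
      using islimpt_subset[OF that dense] by (simp add: limpt_of_closure)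
  qed
  have iso: "(\<exists>v. v \<noteq> 0 \<and> op_kernel (shifted T (complex_of_real \<nu>)) = cell2.span {v})
      \<and> fredholm (shifted T (complex_of_real \<nu>))"
    if \<nu>: "\<nu> \<in> \<Lambda>" "\<not> \<nu> islimpt \<Lambda>" for \<nu>
  proof -
    have "\<not> \<nu> islimpt range lam" using \<nu>(2) islimpt_subset sub by blast
    then obtain k where k: "\<nu> = lam k" using \<nu>(1) dense by (auto simp: closure_def)
    obtain d where d: "0 < d" "\<And>x. x \<in> \<Lambda> \<Longrightarrow> x \<noteq> \<nu> \<Longrightarrow> d \<le> dist x \<nu>"
      using \<nu>(2) unfolding islimpt_approachable by (meson not_less)
    have gap: "d \<le> \<bar>lam i - lam k\<bar>" if "i \<noteq> k" for i
      using d(2)[of "lam i"] sub inj that by (auto simp: k dist_real_def inj_eq)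
    show ?thesis unfolding k by (intro conjI isolated_point[OF d(1) gap])
  qed
  have dim1: "cell2.dim (op_kernel (shifted T (complex_of_real \<nu>))) = 1"
    if \<nu>: "\<nu> \<in> \<Lambda>" "\<not> \<nu> islimpt \<Lambda>" for \<nu>
  proof -
    obtain v where v: "v \<noteq> 0" "op_kernel (shifted T (complex_of_real \<nu>)) = cell2.span {v}"
      using iso[OF \<nu>] by (elim exE conjE) (rule that)
    have "cell2.independent {v}" using v(1) by simp
    then show ?thesis unfolding v(2) by (simp add: cell2.dim_span cell2.dim_eq_card_independent)
  qed
  have spec: "op_spectrum T = complex_of_real ` \<Lambda>"
  proof (rule equalityI)
    show "op_spectrum T \<subseteq> complex_of_real ` \<Lambda>" using off by (auto simp: op_spectrum_def)
    have "\<not> bounded_invertible (shifted T (complex_of_real \<nu>))" if \<nu>: "\<nu> \<in> \<Lambda>" for \<nu>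
    proof (cases "\<nu> islimpt \<Lambda>")
      case True
      then show ?thesis
        using lim bounded_invertible_imp_fredholm bounded_clinear_shifted[OF T] by blast
    next
      case False
      obtain v where v: "v \<noteq> 0" "op_kernel (shifted T (complex_of_real \<nu>)) = cell2.span {v}"
        using iso[OF \<nu> False] by (elim exE conjE) (rule that)
      have "v \<in> op_kernel (shifted T (complex_of_real \<nu>))"
        unfolding v(2) by (rule cell2.span_base) simp
      then have "shifted T (complex_of_real \<nu>) v = shifted T (complex_of_real \<nu>) 0"
        using bounded_clinearD(5)[OF bounded_clinear_shifted[OF T]] by (simp add: op_kernel_def)
      then show ?thesis
        using v(1) unfolding bounded_invertible_def by (metis comp_apply id_apply)
    qed
    then show "complex_of_real ` \<Lambda> \<subseteq> op_spectrum T" by (auto simp: op_spectrum_def)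
  qed
  have disc: "op_spectrum T - ess_spectrum T = complex_of_real ` (\<Lambda> - {x. x islimpt \<Lambda>})"
    unfolding spec ess_spectrum_def using lim iso by auto
  have "cell2.dim (op_kernel (shifted T \<mu>)) = 1" if \<mu>: "isolated_eigenvalue T \<mu>" for \<mu>
  proof -
    have i: "\<mu> isolated_in complex_of_real ` \<Lambda>"
      using \<mu> spec by (simp add: isolated_eigenvalue_def)
    then obtain \<nu> where \<nu>: "\<mu> = complex_of_real \<nu>" "\<nu> \<in> \<Lambda>" by (auto simp: isolated_in_islimpt_iff)
    have "\<not> \<nu> islimpt \<Lambda>"
    proof
      assume "\<nu> islimpt \<Lambda>"
      then have "\<mu> islimpt complex_of_real ` \<Lambda>"
        unfolding \<nu>(1) islimpt_approachable by (force simp: dist_of_real)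
      then show False using i by (simp add: isolated_in_islimpt_iff)
    qed
    then show ?thesis unfolding \<nu>(1) using dim1 \<nu>(2) by blast
  qed
  then show ?thesis using disc dim1 by auto
qed

end
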